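(* Let $\mu=k-1$ (smoothest B-splines) and $k\ge2$. For an interior element mapped to $[-1,1]$, the superconvergence points of $e^{(s)}(x)$ ($0\le s\le k$ when the point lies inside the element, $0\le s\le\mu$ when it is a node) are the zeros of $F_{k-s}$: (i) If $k-s$ is even, $F_{k-s}$ has simple zeros at $-1,0,1$, so $e^{(s)}(x)$ exhibits superconvergence at the element endpoints and the midpoint (for $s=k$, where endpoints are not admissible since $s>\mu$ and $F_0=L_1$, only the midpoint $0$ occurs). (ii) If $k-s$ is odd, $F_{k-s}$ has exactly two simple symmetric zeros $\pm a_{k-s}\in(-1,1)$, so $e^{(s)}(x)$ exhibits superconvergence at two symmetric interior points. These points approach $\pm\frac12$ as $k-s\to\infty$, with $$a_n-\frac12=\frac1{\pi2^{n+1}}-\frac1{\pi4^{n+1}}+\frac4{\pi6^{n+1}}-\frac{17}{6\pi8^{n+1}}+O\!\left(\frac1{10^{n+1}}\right)\qquad(n=k-s\text{ odd},\ n\to\infty).$$ There are no other superconvergence points in $[-1,1]$.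
   Context: $L_j$ is the Legendre polynomial of degree $j$. The linear operator $\mathcal F$ on $\operatorname{span}\{L_1,L_2,\dots\}$ is given by $\mathcal F(L_1)=\frac13L_2$ and $\mathcal F(L_j)=\frac1{2j+1}(L_{j+1}-L_{j-1})$ for $j\ge2$; $F_n=\mathcal F^{n}(L_1)$ ($n$-fold iterate) for $n\ge1$, and $F_0=L_1$. Setting. $\Omega=(a,b)$; $u$ (sufficiently smooth) solves $-u''=f$ in $\Omega$, $u(a)=u(b)=0$; $a=x_1<\dots<x_{N+1}=b$ is a quasi-uniform family of partitions, $h=\max_i(x_{i+1}-x_i)$, $I_i=[x_i,x_{i+1}]$; $S_h^{k,\mu}(\Omega)=\{\chi\in C^\mu(\Omega):\chi|_{I_i}\in\mathcal P_k(I_i)\ \forall i\}$; $V_h=S_h^{k,\mu}(\Omega)\cap H_0^1(\Omega)$; $u_h\in V_h$ satisfies $\int_\Omega(u-u_h)'\chi'\,dx=0$ for all $\chi\in V_h$; $e=u-u_h$. An interior element is an element $I_i$ with midpoint $x_{i+1/2}$ satisfying $|x_{i+1/2}-x_0|=O(h)$ for a point $x_0\in\Omega$ such that the mesh is uniform (elements of length $h$) within $B_d(x_0)\subset\Omega$, a union of whole elements centered at $x_0$ of size $d=C^*h|\ln h|$ with $C^*$ a sufficiently large constant. It is mapped to $[-1,1]$ by $t=2(x-x_{i+1/2})/h$. On such elements $e=\sum_{j\in\mathcal U_k}c_jL_j(t)+O(h^{k+2})$, where $\mathcal U_k=\{0\le j\le k+1:\ j\equiv k+1\ (\mathrm{mod}\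 2)\}$ and the leading-order coefficients $c_j$ are independent of $i$. For odd $k$ the coefficient $c_0$ is regarded in the paper as being of higher order and absorbed in the remainder. The leading-order error polynomial is $P(t)=\sum_{j\in\mathcal U_k\setminus\{0\}}c_jL_j(t)$, with $O(h^{k+2})$ perturbations of the coefficients discarded and considered up to its (nonzero) scale factor $c_{k+1}$. The superconvergence points of $e^{(s)}$ are the zeros in $[-1,1]$ of the leading-order term $P^{(s)}$ of $e^{(s)}$. *)

theory Defs
  imports
    "HOL-Analysis.Analysis"
    "HOL-Computational_Algebra.Polynomial"
    "HOL-Library.Landau_Symbols"
begin

section \<open>Legendre polynomials and the iterated operator\<close>

fun legendre :: "nat \<Rightarrow> real poly" where
  "legendre 0 = 1"
| "legendre (Suc 0) = [:0, 1:]"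
| "legendre (Suc (Suc n)) =
     smult (1 / real (n + 2))
       (smult (real (2 * n + 3)) ([:0, 1:] * legendre (Suc n)) - smult (real (n + 1)) (legendre n))"

definition calF_legendre :: "nat \<Rightarrow> real poly" where
  "calF_legendre j =
     (if j = 1 then smult (1 / 3) (legendre 2)
      else smult (1 / real (2 * j + 1)) (legendre (j + 1) - legendre (j - 1)))"

text \<open>
  The linear extension of \<^const>\<open>calF_legendre\<close> to the span of the Legendre polynomials of
  positive degree.  These are linearly independent, so on the span the description determines a
  unique polynomial; the value elsewhere is irrelevant.
\<close>

definition calF :: "real poly \<Rightarrow> real poly" where
  "calF p = (THE q. \<forall>m (a :: nat \<Rightarrow> real).
      p = (\<Sum>j = 1..m. smult (a j) (legendre j)) \<longrightarrow>
      q = (\<Sum>j = 1..m. smult (a j) (calF_legendre j)))"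

definition Fpoly :: "nat \<Rightarrow> real poly" where
  "Fpoly n = (calF ^^ n) (legendre 1)"

text \<open>Only meaningful for odd \<open>n\<close>, where the zero is unique.\<close>

definition pos_zero :: "nat \<Rightarrow> real" where
  "pos_zero n = (THE t. 0 < t \<and> t < 1 \<and> poly (Fpoly n) t = 0)"


section \<open>Meshes and spline spaces\<close>

text \<open>
  A mesh with \<open>N\<close> elements is given by its nodes \<open>x 1, \<dots>, x (N + 1)\<close>; the values of \<open>x\<close> at
  other indices play no role.
\<close>

definition is_mesh :: "real \<Rightarrow> real \<Rightarrow> nat \<Rightarrow> (nat \<Rightarrow> real) \<Rightarrow> bool" where
  "is_mesh a b N x \<longleftrightarrow> 1 \<le> N \<and> x 1 = a \<and> x (N + 1) = b \<and> (\<forall>i\<in>{1..N}. x i < x (i + 1))"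

definition mesh_size :: "nat \<Rightarrow> (nat \<Rightarrow> real) \<Rightarrow> real" where
  "mesh_size N x = Max ((\<lambda>i. x (i + 1) - x i) ` {1..N})"

definition quasi_uniform :: "(nat \<Rightarrow> nat) \<Rightarrow> (nat \<Rightarrow> nat \<Rightarrow> real) \<Rightarrow> bool" where
  "quasi_uniform N x \<longleftrightarrow>
     (\<exists>q>0. \<forall>n. \<forall>i\<in>{1..N n}. q * mesh_size (N n) (x n) \<le> x n (i + 1) - x n i)"

definition C_on :: "nat \<Rightarrow> (real \<Rightarrow> real) \<Rightarrow> real set \<Rightarrow> bool" where
  "C_on m f S \<longleftrightarrow>
     (\<exists>D :: nat \<Rightarrow> real \<Rightarrow> real.
        (\<forall>y\<in>S. D 0 y = f y) \<and>
        (\<forall>j<m. \<forall>y\<in>S. (D j has_real_derivative D (Suc j) y) (at y within S)) \<and>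
        (\<forall>j\<le>m. continuous_on S (D j)))"

definition spline_space :: "nat \<Rightarrow> nat \<Rightarrow> nat \<Rightarrow> (nat \<Rightarrow> real) \<Rightarrow> (real \<Rightarrow> real) set" where
  "spline_space k \<mu> N x =
     {v. C_on \<mu> v {x 1<..<x (N + 1)} \<and>
         (\<forall>i\<in>{1..N}. \<exists>p :: real poly. degree p \<le> k \<and> (\<forall>y\<in>{x i..x (i + 1)}. v y = poly p y))}"

text \<open>
  The one-dimensional space \<open>H\<^sup>1\<^sub>0(a, b)\<close>, through absolutely continuous representatives: \<open>g\<close> is
  the weak derivative of \<open>v\<close>.
\<close>

definition H10 :: "real \<Rightarrow> real \<Rightarrow> (real \<Rightarrow> real) set" where
  "H10 a b =
     {v. \<exists>g :: real \<Rightarrow> real. set_borel_measurable lborel {a..b} g \<and>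
          set_integrable lborel {a..b} (\<lambda>y. (g y)\<^sup>2) \<and>
          (\<forall>y\<in>{a..b}. v y = (LBINT z:{a..y}. g z)) \<and> v b = 0}"

definition Vh :: "nat \<Rightarrow> nat \<Rightarrow> nat \<Rightarrow> (nat \<Rightarrow> real) \<Rightarrow> (real \<Rightarrow> real) set" where
  "Vh k \<mu> N x = spline_space k \<mu> N x \<inter> H10 (x 1) (x (N + 1))"


section \<open>Interior elements\<close>

text \<open>
  The union \<open>[x l, x r]\<close> of whole elements, centred at \<open>x0\<close>, plays the role of the ball of size
  \<open>C h |ln h|\<close>.  As that number need not be compatible with whole elements, it is used as a lower
  bound for the half-width.
\<close>

definition uniform_near :: "real \<Rightarrow> real \<Rightarrow> nat \<Rightarrow> (nat \<Rightarrow> real) \<Rightarrow> bool" where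
  "uniform_near C x0 N x \<longleftrightarrow>
     (\<exists>l r. 1 \<le> l \<and> l < r \<and> r \<le> N + 1 \<and> (x l + x r) / 2 = x0 \<and>
        C * mesh_size N x * \<bar>ln (mesh_size N x)\<bar> \<le> (x r - x l) / 2 \<and>
        (\<forall>i\<in>{l..<r}. x (i + 1) - x i = mesh_size N x))"

definition midpt :: "(nat \<Rightarrow> real) \<Rightarrow> nat \<Rightarrow> real" where
  "midpt x i = (x i + x (i + 1)) / 2"

text \<open>\<open>K\<close> is the constant in \<open>|x\<^bsub>i+1/2\<^esub> - x0| = O(h)\<close>.\<close>

definition interior_elements :: "real \<Rightarrow> real \<Rightarrow> nat \<Rightarrow> (nat \<Rightarrow> real) \<Rightarrow> nat set" where
  "interior_elements K x0 N x = {i\<in>{1..N}. \<bar>midpt x i - x0\<bar> \<le> K * mesh_size N x}"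


section \<open>Leading-order error\<close>

definition parity_indices :: "nat \<Rightarrow> nat set" where
  "parity_indices k = {j. j \<le> k + 1 \<and> j mod 2 = (k + 1) mod 2}"

text \<open>
  In a family of meshes indexed by \<open>n\<close>, the error \<open>e n\<close> has the leading-order coefficients \<open>c n j\<close>:
  they may depend on the mesh but not on the element, and the remainder is uniform over the
  interior elements for every choice of the constant \<open>K\<close>.  For odd \<open>k\<close> the constant term is of
  higher order.
\<close>

definition error_expansion ::
  "nat \<Rightarrow> real \<Rightarrow> (nat \<Rightarrow> nat) \<Rightarrow> (nat \<Rightarrow> nat \<Rightarrow> real) \<Rightarrow> (nat \<Rightarrow> real \<Rightarrow> real) \<Rightarrow> (nat \<Rightarrow> nat \<Rightarrow> real) \<Rightarrow> bool"
where
  "error_expansion k x0 N x e c \<longleftrightarrow>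
     (\<forall>K. \<exists>C. \<forall>\<^sub>F n in sequentially.
        \<forall>i\<in>interior_elements K x0 (N n) (x n). \<forall>y\<in>{x n i..x n (i + 1)}.
          \<bar>e n y - (\<Sum>j\<in>parity_indices k.
              c n j * poly (legendre j) (2 * (y - midpt (x n) i) / mesh_size (N n) (x n)))\<bar>
          \<le> C * mesh_size (N n) (x n) ^ (k + 2)) \<and>
     (odd k \<longrightarrow> (\<lambda>n. c n 0) \<in> O(\<lambda>n. mesh_size (N n) (x n) ^ (k + 2)))"

text \<open>
  The polynomial \<open>\<Sum>j. c n j L\<^sub>j\<close>, without its constant term, divided by the scale factor
  \<open>c n (k + 1)\<close>, after discarding perturbations of size \<open>h\<^bsup>k+2\<^esup>\<close> of the coefficients \<open>c n j\<close>.
\<close>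

definition leading_error_poly ::
  "nat \<Rightarrow> (nat \<Rightarrow> real) \<Rightarrow> (nat \<Rightarrow> nat \<Rightarrow> real) \<Rightarrow> real poly \<Rightarrow> bool" where
  "leading_error_poly k h c P \<longleftrightarrow>
     (\<exists>g :: nat \<Rightarrow> real.
        P = (\<Sum>j\<in>parity_indices k - {0}. smult (g j) (legendre j)) \<and>
        (\<forall>j\<in>parity_indices k - {0}. (\<lambda>n. c n j - c n (k + 1) * g j) \<in> O(\<lambda>n. h n ^ (k + 2))))"

text \<open>
  A derivative of order \<open>s\<close> is considered up to \<open>s = k\<close> inside an element, but only up to
  \<open>s = \<mu>\<close> at a node.
\<close>

definition admissible :: "nat \<Rightarrow> nat \<Rightarrow> nat \<Rightarrow> real \<Rightarrow> bool" where
  "admissible k \<mu> s t \<longleftrightarrow> (-1 < t \<and> t < 1 \<and> s \<le> k) \<or> ((t = -1 \<or> t = 1) \<and> s \<le> \<mu>)"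

definition superconvergence_points :: "nat \<Rightarrow> nat \<Rightarrow> real poly \<Rightarrow> nat \<Rightarrow> real set" where
  "superconvergence_points k \<mu> P s = {t. admissible k \<mu> s t \<and> poly ((pderiv ^^ s) P) t = 0}"

end

theory Submission
  imports Defs
begin

text \<open>
Up to scaling, \<open>F\<^sub>n\<close> is the Bernoulli polynomial \<open>B\<^bsub>n+1\<^esub>\<close> transported from \<open>[0, 1]\<close> to \<open>[-1, 1]\<close>:
as \<open>(2 j + 1) L\<^sub>j = L'\<^bsub>j+1\<^esub> - L'\<^bsub>j-1\<^esub>\<close>, the operator \<open>\<F>\<close> sends a polynomial of mean
zero on \<open>[-1, 1]\<close> to its antiderivative of mean zero (\<open>calF_zero_mean_antiderivative\<close>).  Three
properties of \<open>F\<^sub>n\<close> follow and carry the whole argument: \<open>F'\<^bsub>n+1\<^esub> = F\<^sub>n\<close>, the parity of \<open>n + 1\<close>, and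
equal values at the two endpoints for \<open>n \<ge> 1\<close>.

The leading error polynomial.  On two adjacent elements of length \<open>h\<close> near \<open>x\<^sub>0\<close>, the pieces of \<open>u\<^sub>h\<close>
have the same derivatives up to order \<open>k - 1\<close> at the common node, and \<open>u\<close> agrees with a single
Taylor polynomial up to \<open>O(h\<^bsup>k+2\<^esup>)\<close>.  Since the same \<open>Q = \<Sum> c\<^sub>j L\<^sub>j\<close> describes the error on both
elements, \<open>Q(s + 1) - Q(s - 1)\<close> has coefficients \<open>O(h\<^bsup>k+2\<^esup>)\<close> below order \<open>k\<close>
(\<open>shift_diff_error_poly\<close>).  For \<open>F\<^sub>k\<close> this central difference is exactly \<open>2 s\<^sup>k / k!\<close>.  Subtracting
from \<open>Q\<close> the multiple of \<open>F\<^sub>k\<close> with the same \<open>L\<^bsub>k+1\<^esub>\<close>-coefficient leaves a combination of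
\<open>L\<^sub>j\<close>, \<open>j \<le> k\<close>, whose central difference is small; the difference operator lowers the degree by exactly
one, so back substitution shows that the coefficients at \<open>j \<ge> 1\<close> are small
(\<open>leading_coefficients\<close>).  Hence the leading error polynomial is a nonzero multiple of \<open>F\<^sub>k\<close>, and
its \<open>s\<close>-th derivative is the same multiple of \<open>F\<^bsub>k-s\<^esub>\<close>.

The zeros.  For even \<open>n > 0\<close>, oddness and the equal endpoint values force zeros at \<open>-1, 0, 1\<close>.  A
further zero in \<open>(0, 1)\<close> would give, by Rolle twice, a zero of \<open>F\<^bsub>n-2\<^esub>\<close> there, and \<open>F\<^sub>0 = t\<close> has
none.  For odd \<open>n\<close>, Rolle applied to \<open>F\<^bsub>n+1\<^esub>\<close> gives a zero in \<open>(0, 1)\<close>, and a second one in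
\<open>[0, 1]\<close> would give a zero of \<open>F\<^bsub>n-1\<^esub>\<close> inside.

The asymptotics.  For odd \<open>n\<close> and \<open>0 < t < 1\<close>, \<open>F\<^sub>n(t)\<close> is a multiple of
\<open>\<Sum>\<^bsub>j\<ge>1\<^esub> (-1)\<^sup>j cos(j \<pi> t) / j\<^bsup>n+1\<^esup>\<close> (\<open>Fpoly_fourier\<close>).  At the positive zero \<open>t = 1/2 + \<theta>/\<pi>\<close> the first
nine harmonics determine \<open>\<theta>\<close> up to \<open>O(10\<^bsup>-(n+1)\<^esup>)\<close>: the resulting equation
\<open>sin \<theta> = cos(2 \<theta>) / 2\<^bsup>n+1\<^esup> + sin(3 \<theta>) / 3\<^bsup>n+1\<^esup> - \<dots>\<close> is solved by inserting
\<open>\<theta> = 2\<^bsup>-(n+1)\<^esup> + O(4\<^bsup>-(n+1)\<^esup>)\<close> into its Taylor expansion (\<open>pos_zero_expansion\<close>).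
\<close>

section \<open>Legendre polynomials\<close>

lemma legendre_rec: "real (n+2) * poly (legendre (Suc (Suc n))) x
  = real (2*n+3) * x * poly (legendre (Suc n)) x - real (n+1) * poly (legendre n) x"
  unfolding legendre.simps(3)[of n] by (simp del: legendre.simps)

lemma legendre_rec_pderiv:
  "real (n + 2) * poly (pderiv (legendre (Suc (Suc n)))) x =
     real (2 * n + 3) * (poly (legendre (Suc n)) x + x * poly (pderiv (legendre (Suc n))) x)
       - real (n + 1) * poly (pderiv (legendre n)) x"
proof -
  have "pderiv (legendre (Suc (Suc n))) =
    smult (1 / real (n + 2)) (smult (real (2 * n + 3)) (legendre (Suc n) + [:0, 1:] * pderiv (legendre (Suc n)))
      - smult (real (n + 1)) (pderiv (legendre n)))"
    unfolding legendre.simps(3)[of n]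
    by (simp only: pderiv_smult pderiv_diff pderiv_mult)
        (simp add: pderiv_pCons add.commute del: legendre.simps)
  then show ?thesis by (simp del: legendre.simps)
qed

text \<open>
The two classical ladder relations are proved together, because each needs the other in the
induction step; adding them gives the formula for \<open>L'\<^bsub>n+2\<^esub> - L'\<^sub>n\<close>.
\<close>

lemma legendre_pderiv_up_down:
  "poly (pderiv (legendre (Suc n))) x = x * poly (pderiv (legendre n)) x + real (n+1) * poly (legendre n) x
   \<and> x * poly (pderiv (legendre (Suc n))) x
       = poly (pderiv (legendre n)) x + real (n+1) * poly (legendre (Suc n)) x"
proof (induction n)
  case 0
  then show ?case by (simp add: pderiv_pCons)
next
  case (Suc n)
  define p0 p1 p2 d0 d1 d2 where
    "p0 = poly (legendre n) x" and "p1 = poly (legendre (Suc n)) x" and "p2 = poly (legendre (Suc (Suc n))) x"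
    and "d0 = poly (pderiv (legendre n)) x" and "d1 = poly (pderiv (legendre (Suc n))) x"
    and "d2 = poly (pderiv (legendre (Suc (Suc n)))) x"
  note defs = this
  have A: "d1 = x * d0 + (real n + 1) * p0" and B: "x * d1 = d0 + (real n + 1) * p1"
    using Suc unfolding defs by (auto simp del: legendre.simps simp: add.commute)
  have R: "(real n + 2) * p2 = (2 * real n + 3) * x * p1 - (real n + 1) * p0"
    using legendre_rec[of n x] by (simp add: defs del: legendre.simps add: algebra_simps)
  have D: "(real n + 2) * d2 = (2 * real n + 3) * (p1 + x * d1) - (real n + 1) * d0"
    using legendre_rec_pderiv[of n x] by (simp add: defs del: legendre.simps add: algebra_simps)
  have d0: "d0 = x * d1 - (real n + 1) * p1" using B by simp
  have "(real n + 2) * d2 = (real n + 2) * (x * d1 + (real n + 2) * p1)"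
    unfolding D d0 by (simp add: algebra_simps)
  moreover have "real n + 2 \<noteq> 0" by linarith
  ultimately have A': "d2 = x * d1 + (real n + 2) * p1" by (metis mult_left_cancel)
  have "x * d2 = x * (x * d1) + (real n + 2) * x * p1"
    unfolding A' by (simp add: algebra_simps)
  also have "x * (x * d1) = x * d0 + (real n + 1) * x * p1"
    unfolding B by (simp add: algebra_simps)
  also have "x * d0 = d1 - (real n + 1) * p0" using A by simp
  finally have B': "x * d2 = d1 + (real n + 2) * p2"
    unfolding R by (simp add: algebra_simps)
  show ?case using A' B' by (simp add: defs del: legendre.simps add: add.commute)
qed

lemma pderiv_legendre_diff:
  "pderiv (legendre (Suc (Suc n))) - pderiv (legendre n) = smult (real (2 * n + 3)) (legendre (Suc n))"
proof (rule poly_ext)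
  fix x
  show "poly (pderiv (legendre (Suc (Suc n))) - pderiv (legendre n)) x
      = poly (smult (real (2 * n + 3)) (legendre (Suc n))) x"
    using conjunct2[OF legendre_pderiv_up_down[of n x]] conjunct1[OF legendre_pderiv_up_down[of "Suc n" x]]
    by (simp only: poly_diff poly_smult) (simp add: algebra_simps del: legendre.simps)
qed

lemma legendre_reflect: "poly (legendre n) (- x) = (-1) ^ n * poly (legendre n) x"
  by (induction n rule: legendre.induct) (simp_all add: algebra_simps)

lemma legendre_one: "poly (legendre n) 1 = 1"
  by (induction n rule: legendre.induct) (simp_all add: field_simps)

lemma legendre_minus_one: "poly (legendre n) (- 1) = (-1) ^ n"
  by (simp add: legendre_reflect legendre_one)

lemma degree_coeff_legendre: "degree (legendre n) \<le> n \<and> 0 < coeff (legendre n) n"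
proof (induction n rule: legendre.induct)
  case (3 n)
  have "degree (legendre (Suc (Suc n))) \<le> Suc (Suc n)"
    unfolding legendre.simps
    by (intro order.trans[OF degree_smult_le] degree_diff_le order.trans[OF degree_pCons_le]
        order.trans[OF degree_mult_le])
       (use 3 in \<open>auto intro!: order.trans[OF degree_smult_le] order.trans[OF degree_pCons_le]\<close>)
  moreover have "coeff (legendre n) (Suc (Suc n)) = 0"
    using 3 by (intro coeff_eq_0) auto
  ultimately show ?case using 3 by (simp add: mult_pos_pos add_pos_nonneg)
qed auto

lemma degree_legendre: "degree (legendre n) = n"
  using degree_coeff_legendre[of n] by (intro antisym) (auto intro: le_degree)

text \<open>
Subtracting the right multiple of \<open>L\<^bsub>m+1\<^esub>\<close>, whose degree is exactly \<open>m + 1\<close>, lowers the degree.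
\<close>

lemma legendre_expansion:
  assumes "degree p \<le> m"
  shows "\<exists>a. p = (\<Sum>j\<le>m. smult (a j) (legendre j))"
  using assms
proof (induction m arbitrary: p)
  case 0
  then obtain c where "p = [:c:]" by (metis degree_0_id le_zero_eq)
  then show ?case by (intro exI[of _ "\<lambda>_. c"]) simp
next
  case (Suc m)
  define c where "c = coeff p (Suc m) / coeff (legendre (Suc m)) (Suc m)"
  have "coeff (p - smult c (legendre (Suc m))) (Suc m) = 0"
    using degree_coeff_legendre[of "Suc m"] by (simp add: c_def del: legendre.simps)
  moreover have "degree (p - smult c (legendre (Suc m))) \<le> Suc m"
    using Suc.prems degree_legendre[of "Suc m"] by (intro degree_diff_le) auto
  ultimately have "degree (p - smult c (legendre (Suc m))) \<le> m"
    by (metis Zero_not_Suc degree_0 le_SucE leading_coeff_0_iff)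
  then obtain a where a: "p - smult c (legendre (Suc m)) = (\<Sum>j\<le>m. smult (a j) (legendre j))"
    using Suc.IH by blast
  have "p = (\<Sum>j\<le>Suc m. smult ((a(Suc m := c)) j) (legendre j))"
    using a by (simp add: algebra_simps del: legendre.simps)
  then show ?case by blast
qed

section \<open>The operator as zero-mean integration\<close>

text \<open>
The condition says that the integral of \<open>p\<close> over \<open>[-1, 1]\<close> vanishes.  Phrased through an
antiderivative polynomial it stays algebraic.
\<close>

definition zero_mean :: "real poly \<Rightarrow> bool" where
  "zero_mean p \<longleftrightarrow> (\<exists>q. pderiv q = p \<and> poly q 1 = poly q (- 1))"

lemma zero_mean_0: "zero_mean 0"
  unfolding zero_mean_def by (intro exI[of _ 0]) simp

lemma zero_mean_add: "zero_mean p \<Longrightarrow> zero_mean q \<Longrightarrow> zero_mean (p + q)"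
  unfolding zero_mean_def by (metis pderiv_add poly_add)

lemma zero_mean_smult: "zero_mean p \<Longrightarrow> zero_mean (smult c p)"
  unfolding zero_mean_def by (metis pderiv_smult poly_smult)

lemma zero_mean_diff: "zero_mean p \<Longrightarrow> zero_mean q \<Longrightarrow> zero_mean (p - q)"
  using zero_mean_add[of p "smult (-1) q"] zero_mean_smult[of q "-1"] by simp

lemma zero_mean_sum: "(\<And>j. j \<in> A \<Longrightarrow> zero_mean (f j)) \<Longrightarrow> zero_mean (\<Sum>j\<in>A. f j)"
  by (induction A rule: infinite_finite_induct) (auto intro: zero_mean_0 zero_mean_add)

lemma zero_mean_antiderivative:
  assumes "zero_mean (pderiv q)"
  shows "poly q 1 = poly q (- 1)"
proof -
  obtain r where r: "pderiv r = pderiv q" "poly r 1 = poly r (- 1)"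
    using assms unfolding zero_mean_def by blast
  then have "pderiv (q - r) = 0" by (simp add: pderiv_diff)
  then obtain c where "q - r = [:c:]" by (metis degree_0_id pderiv_eq_0_iff)
  then have "q = r + [:c:]" by (simp add: algebra_simps)
  with r show ?thesis by simp
qed

lemma zero_mean_const: "zero_mean [:c:] \<Longrightarrow> c = 0"
  using zero_mean_antiderivative[of "[:0, c:]"] by (simp add: pderiv_pCons)

lemma zero_mean_antiderivative_unique:
  assumes "pderiv p = pderiv q" "zero_mean p" "zero_mean q"
  shows "p = q"
proof -
  have "pderiv (p - q) = 0" using assms by (simp add: pderiv_diff)
  then obtain c where c: "p - q = [:c:]" by (metis degree_0_id pderiv_eq_0_iff)
  then show ?thesis using zero_mean_const[of c] zero_mean_diff[OF assms(2,3)] by simp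
qed

text \<open>
Composition with \<open>[:0, -1:]\<close> is the substitution \<open>t \<mapsto> -t\<close>.
\<close>

lemma zero_mean_reflect:
  assumes "zero_mean p"
  shows "zero_mean (p \<circ>\<^sub>p [:0, -1:])"
proof -
  obtain q where "pderiv q = p" "poly q 1 = poly q (- 1)"
    using assms unfolding zero_mean_def by blast
  then show ?thesis unfolding zero_mean_def
    by (intro exI[of _ "- (q \<circ>\<^sub>p [:0, -1:])"])
        (simp add: pderiv_minus pderiv_pcompose poly_pcompose pderiv_pCons)
qed

text \<open>
\<open>L\<^bsub>j+1\<^esub> - L\<^bsub>j-1\<^esub>\<close> is up to scaling an antiderivative of \<open>L\<^sub>j\<close>, and it vanishes at both endpoints.
\<close>

lemma zero_mean_legendre:
  assumes "0 < j"
  shows "zero_mean (legendre j)"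
proof -
  obtain i where i: "j = Suc i" using assms gr0_conv_Suc by blast
  have "pderiv (legendre (Suc (Suc i)) - legendre i) = smult (real (2 * i + 3)) (legendre j)"
    by (simp add: pderiv_diff pderiv_legendre_diff i del: legendre.simps)
  moreover have "poly (legendre (Suc (Suc i)) - legendre i) 1
      = poly (legendre (Suc (Suc i)) - legendre i) (- 1)"
    by (simp add: legendre_one legendre_minus_one del: legendre.simps)
  ultimately have "zero_mean (smult (real (2 * i + 3)) (legendre j))"
    unfolding zero_mean_def by blast
  from zero_mean_smult[OF this, of "1 / real (2 * i + 3)"] show ?thesis by simp
qed

text \<open>
The exceptional formula for \<open>j = 1\<close> is what makes the antiderivative \<open>(L\<^sub>2 - L\<^sub>0) / 3\<close> of
\<open>L\<^sub>1\<close> have mean zero: the constant \<open>L\<^sub>0\<close> is dropped.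
\<close>

lemma calF_legendre_zero_mean_antiderivative:
  assumes "0 < j"
  shows "pderiv (calF_legendre j) = legendre j" "zero_mean (calF_legendre j)"
proof -
  obtain i where i: "j = Suc i" using assms gr0_conv_Suc by blast
  have eq: "calF_legendre j = smult (1 / real (2 * j + 1))
      (legendre (Suc (Suc i)) - (if j = 1 then 0 else legendre i))"
    by (cases "i = 0") (simp_all add: calF_legendre_def i numeral_2_eq_2 del: legendre.simps)
  have "pderiv (if j = 1 then 0 else legendre i) = pderiv (legendre i)" by (auto simp: i)
  moreover have "2 * real i + 3 \<noteq> 0" by linarith
  ultimately show "pderiv (calF_legendre j) = legendre j"
    unfolding eq pderiv_smult pderiv_diff
    by (simp add: pderiv_legendre_diff i add.commute del: legendre.simps)
  show "zero_mean (calF_legendre j)"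
    unfolding eq by (auto intro!: zero_mean_smult zero_mean_diff zero_mean_legendre zero_mean_0 simp:
        i simp del: legendre.simps)
qed

lemma pderiv_sum: "pderiv (\<Sum>j\<in>A. f j) = (\<Sum>j\<in>A. pderiv (f j))"
  by (induction A rule: infinite_finite_induct) (auto simp: pderiv_add)

text \<open>
Mean zero places \<open>p\<close> in the span of \<open>L\<^sub>1, L\<^sub>2, \<dots>\<close>.  The definite description in \<^const>\<open>calF\<close> is
then well defined, because every expansion of \<open>p\<close> leads to a mean-zero antiderivative of \<open>p\<close> and
there is only one of these.
\<close>

lemma calF_zero_mean_antiderivative:
  assumes "zero_mean p"
  shows "pderiv (calF p) = p" "zero_mean (calF p)"
proof -
  define Q where "Q m a = (\<Sum>j = 1..m. smult (a j) (calF_legendre j))" for m :: nat and a :: "nat \<Rightarrow> real"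
  have Q: "pderiv (Q m a) = (\<Sum>j = 1..m. smult (a j) (legendre j))" "zero_mean (Q m a)" for m a
    unfolding Q_def
    by (auto simp: pderiv_sum pderiv_smult calF_legendre_zero_mean_antiderivative
          intro!: sum.cong zero_mean_sum zero_mean_smult)
  obtain a where a: "p = (\<Sum>j\<le>degree p. smult (a j) (legendre j))"
    using legendre_expansion by blast
  also have "\<dots> = (\<Sum>j = 1..degree p. smult (a j) (legendre j)) + [:a 0:]"
    by (simp add: atMost_atLeast0 sum.atLeast_Suc_atMost del: legendre.simps(2,3))
  finally have p: "p = (\<Sum>j = 1..degree p. smult (a j) (legendre j)) + [:a 0:]" .
  have "zero_mean (\<Sum>j = 1..degree p. smult (a j) (legendre j))"
    by (auto intro!: zero_mean_sum zero_mean_smult zero_mean_legendre)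
  from zero_mean_diff[OF assms this] p have "zero_mean [:a 0:]" by (metis add_diff_cancel_left')
  then have p: "p = (\<Sum>j = 1..degree p. smult (a j) (legendre j))"
    using p zero_mean_const[of "a 0"] by simp
  have "calF p = Q (degree p) a"
    unfolding calF_def
  proof (rule the_equality)
    show "\<forall>m b. p = (\<Sum>j = 1..m. smult (b j) (legendre j)) \<longrightarrow> Q (degree p) a
        = (\<Sum>j = 1..m. smult (b j) (calF_legendre j))"
    proof (intro allI impI)
      fix m b assume b: "p = (\<Sum>j = 1..m. smult (b j) (legendre j))"
      have "pderiv (Q (degree p) a) = pderiv (Q m b)" using Q(1) p b by metis
      then have "Q (degree p) a = Q m b"
        using zero_mean_antiderivative_unique Q(2) by blast
      then show "Q (degree p) a = (\<Sum>j = 1..m. smult (b j) (calF_legendre j))" by (simp add: Q_def)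
    qed
  next
    fix q assume "\<forall>m a. p = (\<Sum>j = 1..m. smult (a j) (legendre j)) \<longrightarrow> q
        = (\<Sum>j = 1..m. smult (a j) (calF_legendre j))"
    then show "q = Q (degree p) a" unfolding Q_def using p by blast
  qed
  then show "pderiv (calF p) = p" "zero_mean (calF p)" using Q p by metis+
qed

lemma Fpoly_0: "Fpoly 0 = [:0, 1:]"
  by (simp add: Fpoly_def)

lemma zero_mean_Fpoly: "zero_mean (Fpoly n)"
  by (induction n) (simp_all add: Fpoly_def calF_zero_mean_antiderivative zero_mean_legendre del:
      legendre.simps)

lemma pderiv_Fpoly: "pderiv (Fpoly (Suc n)) = Fpoly n"
  using calF_zero_mean_antiderivative[OF zero_mean_Fpoly[of n]] by (simp add: Fpoly_def)

lemma pderiv_power_Fpoly: "s \<le> n \<Longrightarrow> (pderiv ^^ s) (Fpoly n) = Fpoly (n - s)"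
proof (induction s)
  case (Suc s)
  then have "(pderiv ^^ Suc s) (Fpoly n) = pderiv (Fpoly (Suc (n - Suc s)))"
    by (simp add: Suc_diff_Suc)
  then show ?case by (simp only: pderiv_Fpoly)
qed simp

lemma Fpoly_endpoints: "poly (Fpoly (Suc n)) 1 = poly (Fpoly (Suc n)) (- 1)"
  using zero_mean_antiderivative[of "Fpoly (Suc n)"] by (simp add: pderiv_Fpoly zero_mean_Fpoly)

text \<open>
Both sides have mean zero and, by induction, the same derivative.
\<close>

lemma Fpoly_reflect_poly: "Fpoly n \<circ>\<^sub>p [:0, -1:] = smult ((-1) ^ Suc n) (Fpoly n)"
proof (induction n)
  case 0
  then show ?case by (simp add: Fpoly_0 pcompose_pCons)
next
  case (Suc n)
  have "pderiv (Fpoly (Suc n) \<circ>\<^sub>p [:0, -1:]) = pderiv (smult ((-1) ^ Suc (Suc n)) (Fpoly (Suc n)))"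
    by (simp add: pderiv_pcompose pderiv_Fpoly pderiv_smult pderiv_pCons Suc)
  then show ?case
    by (rule zero_mean_antiderivative_unique)
       (intro zero_mean_reflect zero_mean_smult zero_mean_Fpoly)+
qed

lemma Fpoly_reflect: "poly (Fpoly n) (- x) = (-1) ^ Suc n * poly (Fpoly n) x"
  using arg_cong[OF Fpoly_reflect_poly[of n], of "\<lambda>p. poly p x"] by (simp add: poly_pcompose)

lemma Fpoly_even_zeros:
  assumes "even n" "0 < n"
  shows "poly (Fpoly n) 0 = 0" "poly (Fpoly n) 1 = 0" "poly (Fpoly n) (- 1) = 0"
proof -
  obtain m where m: "n = Suc m" using assms gr0_conv_Suc by blast
  show "poly (Fpoly n) 0 = 0" using Fpoly_reflect[of n 0] assms by simp
  show "poly (Fpoly n) 1 = 0" "poly (Fpoly n) (- 1) = 0"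
    using Fpoly_reflect[of n 1] Fpoly_endpoints[of m] assms by (simp_all add: m)
qed

lemma degree_coeff_Fpoly: "degree (Fpoly n) = Suc n" "coeff (Fpoly n) (Suc n) = 1 / fact (Suc n)"
proof -
  have "degree (Fpoly n) = Suc n \<and> coeff (Fpoly n) (Suc n) = 1 / fact (Suc n)"
  proof (induction n)
    case (Suc n)
    have "degree (Fpoly (Suc n)) - 1 = Suc n"
      using Suc degree_pderiv[of "Fpoly (Suc n)"] by (simp add: pderiv_Fpoly)
    moreover have "real (Suc (Suc n)) * coeff (Fpoly (Suc n)) (Suc (Suc n)) = 1 / fact (Suc n)"
      using Suc coeff_pderiv[of "Fpoly (Suc n)" "Suc n"] by (simp add: pderiv_Fpoly)
    ultimately show ?case
      using fact_Suc[of "Suc n", where 'a = real]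
          by (simp add: eq_divide_eq del: fact_Suc) (simp add: field_simps)
  qed (simp add: Fpoly_0)
  then show "degree (Fpoly n) = Suc n" "coeff (Fpoly n) (Suc n) = 1 / fact (Suc n)" by auto
qed

text \<open>
Parity removes every second Legendre polynomial from the expansion and mean zero removes \<open>L\<^sub>0\<close>.
The coefficient of \<open>L\<^bsub>n+1\<^esub>\<close> survives since the degree of \<open>F\<^sub>n\<close> is \<open>n + 1\<close>.
\<close>

lemma Fpoly_legendre_expansion:
  "\<exists>a. a (n + 1) \<noteq> 0 \<and> Fpoly n = (\<Sum>j\<in>parity_indices n - {0}. smult (a j) (legendre j))"
proof -
  obtain a where a: "Fpoly n = (\<Sum>j\<le>Suc n. smult (a j) (legendre j))"
    using legendre_expansion[of "Fpoly n" "Suc n"] degree_coeff_Fpoly by auto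
  have fin: "finite (parity_indices n)" "parity_indices n \<subseteq> {..Suc n}"
    by (auto simp: parity_indices_def intro: finite_subset[of _ "{..Suc n}"])
  have par: "Fpoly n = (\<Sum>j\<in>parity_indices n. smult (a j) (legendre j))"
  proof (rule poly_ext)
    fix x
    \<comment> \<open>Symmetrising the expansion cancels the terms of the wrong parity.\<close>
    have "2 * poly (Fpoly n) x = poly (Fpoly n) x + (-1) ^ Suc n * poly (Fpoly n) (- x)"
      by (simp add: Fpoly_reflect flip: mult.assoc power_add)
    also have "\<dots> = (\<Sum>j\<le>Suc n. a j * poly (legendre j) x * (1 + (-1) ^ Suc n * (-1) ^ j))"
      by (simp add: a poly_sum legendre_reflect sum_distrib_left sum.distrib algebra_simps del:
          legendre.simps sum.atMost_Suc power_Suc)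
    also have "\<dots> = (\<Sum>j\<in>parity_indices n. a j * poly (legendre j) x * 2)"
    proof (intro sum.mono_neutral_cong_right ballI)
      fix j assume "j \<in> {..Suc n} - parity_indices n"
      then have "even (Suc n) \<noteq> even j" by (auto simp: parity_indices_def even_iff_mod_2_eq_zero)
      then show "a j * poly (legendre j) x * (1 + (-1) ^ Suc n * (-1) ^ j) = 0" by auto
    next
      fix j assume "j \<in> parity_indices n"
      then have "even (Suc n) = even j" by (auto simp: parity_indices_def even_iff_mod_2_eq_zero)
      then show "a j * poly (legendre j) x * (1 + (-1) ^ Suc n * (-1) ^ j) = a j * poly (legendre j) x * 2"
        by (auto simp del: power_Suc)
    qed (use fin in auto)
    finally show "poly (Fpoly n) x = poly (\<Sum>j\<in>parity_indices n. smult (a j) (legendre j)) x"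
      by (simp add: poly_sum flip: sum_distrib_right)
  qed
  have pos: "Fpoly n = (\<Sum>j\<in>parity_indices n - {0}. smult (a j) (legendre j))"
  proof (cases "0 \<in> parity_indices n")
    case True
    then have eq: "Fpoly n = [:a 0:] + (\<Sum>j\<in>parity_indices n - {0}. smult (a j) (legendre j))"
      using par fin by (simp add: sum.remove del: legendre.simps(2,3))
    have "zero_mean (\<Sum>j\<in>parity_indices n - {0}. smult (a j) (legendre j))"
      by (auto intro!: zero_mean_sum zero_mean_smult zero_mean_legendre)
    then have "zero_mean [:a 0:]"
      using zero_mean_diff[OF zero_mean_Fpoly[of n]] eq by (metis add_diff_cancel_right')
    then show ?thesis using eq zero_mean_const by fastforce
  qed (use par in simp)
  have "coeff (Fpoly n) (Suc n) = (\<Sum>j\<le>Suc n. a j * coeff (legendre j) (Suc n))"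
    by (simp add: a coeff_sum del: sum.atMost_Suc legendre.simps)
  also have "\<dots> = a (Suc n) * coeff (legendre (Suc n)) (Suc n)"
    by (simp add: coeff_eq_0 degree_legendre del: legendre.simps)
  finally have "a (Suc n) \<noteq> 0" using degree_coeff_Fpoly[of n] by auto
  with pos show ?thesis by (intro exI[of _ a]) auto
qed

section \<open>Zeros\<close>

lemma DERIV_Fpoly: "(poly (Fpoly (Suc n)) has_real_derivative poly (Fpoly n) t) (at t)"
  using poly_DERIV[of "Fpoly (Suc n)" t] by (simp add: pderiv_Fpoly)

lemma Fpoly_Rolle:
  assumes "s < t" "poly (Fpoly (Suc n)) s = poly (Fpoly (Suc n)) t"
  shows "\<exists>z. s < z \<and> z < t \<and> poly (Fpoly n) z = 0"
proof -
  obtain z where "s < z" "z < t" "poly (Fpoly (Suc n)) t - poly (Fpoly (Suc n)) s = (t - s) * poly (Fpoly n) z"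
    using MVT2[OF assms(1), of "poly (Fpoly (Suc n))" "poly (Fpoly n)"] DERIV_Fpoly by blast
  with assms show ?thesis by auto
qed

text \<open>
If \<open>t\<close> were a zero, Rolle between \<open>0\<close>, \<open>t\<close>, \<open>1\<close> would give two zeros of \<open>F\<^bsub>n-1\<^esub>\<close>, and Rolle between
these a zero of \<open>F\<^bsub>n-2\<^esub>\<close> in \<open>(0, 1)\<close>.
\<close>

lemma Fpoly_even_nonzero: "even n \<Longrightarrow> 0 < t \<Longrightarrow> t < 1 \<Longrightarrow> poly (Fpoly n) t \<noteq> 0"
proof (induction n arbitrary: t rule: less_induct)
  case (less n)
  show ?case
  proof (cases "n = 0")
    case True
    then show ?thesis using less.prems by (simp add: Fpoly_0)
  next
    case False
    then obtain m where n: "n = Suc (Suc m)" and m: "even m"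
      using less.prems(1) by (metis even_Suc not0_implies_Suc even_zero)
    show ?thesis
    proof
      assume 0: "poly (Fpoly n) t = 0"
      obtain z1 where z1: "0 < z1" "z1 < t" "poly (Fpoly (Suc m)) z1 = 0"
        using Fpoly_Rolle[of 0 t "Suc m"] less.prems 0 Fpoly_even_zeros[of n] by (auto simp: n)
      obtain z2 where z2: "t < z2" "z2 < 1" "poly (Fpoly (Suc m)) z2 = 0"
        using Fpoly_Rolle[of t 1 "Suc m"] less.prems 0 Fpoly_even_zeros[of n] by (auto simp: n)
      obtain z where "z1 < z" "z < z2" "poly (Fpoly m) z = 0"
        using Fpoly_Rolle[of z1 z2 m] z1 z2 by auto
      then show False using less.IH[of m z] m z1 z2 by (auto simp: n)
    qed
  qed
qed

text \<open>
Existence is Rolle for \<open>F\<^bsub>n+1\<^esub>\<close>, which vanishes at \<open>0\<close> and \<open>1\<close>; a second zero would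
produce a zero of \<open>F\<^bsub>n-1\<^esub>\<close> in \<open>(0, 1)\<close>.
\<close>

lemma Fpoly_odd_zero_ex1:
  assumes "odd n"
  shows "\<exists>z. 0 < z \<and> z < 1 \<and> poly (Fpoly n) z = 0 \<and> (\<forall>t. 0 \<le> t \<and> t \<le> 1 \<and> poly (Fpoly n) t = 0 \<longrightarrow> t = z)"
proof -
  obtain m where n: "n = Suc m" and m: "even m" using assms by (metis even_Suc odd_pos gr0_conv_Suc)
  obtain z where z: "0 < z" "z < 1" "poly (Fpoly n) z = 0"
    using Fpoly_Rolle[of 0 1 n] Fpoly_even_zeros[of "Suc n"] assms by auto
  have "t = z" if t: "0 \<le> t" "t \<le> 1" "poly (Fpoly n) t = 0" for t
  proof (rule ccontr)
    assume "t \<noteq> z"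
    then consider "t < z" | "z < t" by linarith
    then have "\<exists>w. 0 < w \<and> w < 1 \<and> poly (Fpoly m) w = 0"
    proof cases
      case 1
      then obtain w where "t < w" "w < z" "poly (Fpoly m) w = 0"
        using Fpoly_Rolle[of t z m] t(3) z(3) by (auto simp: n)
      with t z show ?thesis by (intro exI[of _ w]) auto
    next
      case 2
      then obtain w where "z < w" "w < t" "poly (Fpoly m) w = 0"
        using Fpoly_Rolle[of z t m] t(3) z(3) by (auto simp: n)
      with t z show ?thesis by (intro exI[of _ w]) auto
    qed
    then show False using Fpoly_even_nonzero[OF m] by blast
  qed
  with z show ?thesis by blast
qed

lemma pos_zero_Fpoly:
  assumes "odd n"
  shows "0 < pos_zero n" "pos_zero n < 1" "poly (Fpoly n) (pos_zero n) = 0"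
    and "\<And>t. 0 \<le> t \<Longrightarrow> t \<le> 1 \<Longrightarrow> poly (Fpoly n) t = 0 \<Longrightarrow> t = pos_zero n"
proof -
  obtain z where z: "0 < z" "z < 1" "poly (Fpoly n) z = 0"
    "\<And>t. 0 \<le> t \<Longrightarrow> t \<le> 1 \<Longrightarrow> poly (Fpoly n) t = 0 \<Longrightarrow> t = z"
    using Fpoly_odd_zero_ex1[OF assms] by blast
  have "pos_zero n = z"
    unfolding pos_zero_def using z by (intro the_equality) auto
  with z show "0 < pos_zero n" "pos_zero n < 1" "poly (Fpoly n) (pos_zero n) = 0"
    "\<And>t. 0 \<le> t \<Longrightarrow> t \<le> 1 \<Longrightarrow> poly (Fpoly n) t = 0 \<Longrightarrow> t = pos_zero n" by auto
qed

lemma Fpoly_reflect_eq_0: "poly (Fpoly n) (- t) = 0 \<longleftrightarrow> poly (Fpoly n) t = 0"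
  by (simp add: Fpoly_reflect)

lemma Fpoly_zeros_0: "{t\<in>{-1..1}. poly (Fpoly 0) t = 0} = {0}"
  by (auto simp: Fpoly_0)

lemma Fpoly_zeros_even:
  assumes "even n" "0 < n"
  shows "{t\<in>{-1..1}. poly (Fpoly n) t = 0} = {-1, 0, 1}"
proof -
  have "t \<in> {-1, 0, 1}" if t: "-1 \<le> t" "t \<le> 1" "poly (Fpoly n) t = 0" for t
  proof (rule ccontr)
    assume "t \<notin> {-1, 0, 1}"
    then have "0 < \<bar>t\<bar>" "\<bar>t\<bar> < 1" using t by auto
    moreover have "poly (Fpoly n) \<bar>t\<bar> = 0" using t Fpoly_reflect_eq_0[of n t] by (auto simp: abs_if)
    ultimately show False using Fpoly_even_nonzero assms by blast
  qed
  then show ?thesis using Fpoly_even_zeros[OF assms] by auto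
qed

lemma Fpoly_zeros_odd:
  assumes "odd n"
  shows "{t\<in>{-1..1}. poly (Fpoly n) t = 0} = {- pos_zero n, pos_zero n}"
proof -
  have "t \<in> {- pos_zero n, pos_zero n}" if t: "-1 \<le> t" "t \<le> 1" "poly (Fpoly n) t = 0" for t
  proof -
    have "poly (Fpoly n) \<bar>t\<bar> = 0" using t Fpoly_reflect_eq_0[of n t] by (auto simp: abs_if)
    then have "\<bar>t\<bar> = pos_zero n" using pos_zero_Fpoly(4)[OF assms, of "\<bar>t\<bar>"] t by auto
    then show ?thesis by auto
  qed
  moreover have "{- pos_zero n, pos_zero n} \<subseteq> {t\<in>{-1..1}. poly (Fpoly n) t = 0}"
    using pos_zero_Fpoly(1-3)[OF assms] by (auto simp: Fpoly_reflect_eq_0)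
  ultimately show ?thesis by auto
qed

lemma simple_zero_Fpoly:
  assumes "poly (Fpoly (Suc n)) t = 0" "poly (Fpoly n) t \<noteq> 0"
  shows "order t (Fpoly (Suc n)) = 1"
proof -
  have nz: "Fpoly (Suc n) \<noteq> 0" using degree_coeff_Fpoly(1)[of "Suc n"] by auto
  have "order t (Fpoly (Suc n)) = Suc (order t (pderiv (Fpoly (Suc n))))"
    by (rule order_pderiv[OF nz assms(1)])
  also have "order t (pderiv (Fpoly (Suc n))) = 0"
    using assms(2) by (simp add: pderiv_Fpoly order_0I)
  finally show ?thesis by simp
qed

lemma order_Fpoly_0: "order 0 (Fpoly 0) = 1"
  using order_power_n_n[of "0::real" 1] by (simp add: Fpoly_0)

text \<open>
The derivative \<open>F\<^bsub>n-1\<^esub>\<close> does not vanish at \<open>-1, 0, 1\<close>, since its zeros in \<open>[-1, 1]\<close> satisfy \<open>0 < \<bar>t\<bar> < 1\<close>.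
\<close>

lemma order_Fpoly_even:
  assumes "even n" "0 < n" "t \<in> {-1, 0, 1}"
  shows "order t (Fpoly n) = 1"
proof -
  obtain m where n: "n = Suc m" and m: "odd m" using assms by (metis even_Suc gr0_conv_Suc)
  have "poly (Fpoly m) t \<noteq> 0"
  proof
    assume "poly (Fpoly m) t = 0"
    then have "t \<in> {t\<in>{-1..1}. poly (Fpoly m) t = 0}" using assms(3) by auto
    then have "t \<in> {- pos_zero m, pos_zero m}" unfolding Fpoly_zeros_odd[OF m] .
    then show False using assms(3) pos_zero_Fpoly(1,2)[OF m] by auto
  qed
  moreover have "poly (Fpoly n) t = 0" using Fpoly_even_zeros[OF assms(1,2)] assms(3) by auto
  ultimately show ?thesis using simple_zero_Fpoly n by blast
qed

lemma order_Fpoly_odd: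
  assumes "odd n"
  shows "order (pos_zero n) (Fpoly n) = 1" "order (- pos_zero n) (Fpoly n) = 1"
proof -
  obtain m where n: "n = Suc m" and m: "even m" using assms by (metis even_Suc odd_pos gr0_conv_Suc)
  have "poly (Fpoly m) (pos_zero n) \<noteq> 0"
    by (rule Fpoly_even_nonzero[OF m pos_zero_Fpoly(1,2)[OF assms]])
  then show "order (pos_zero n) (Fpoly n) = 1" "order (- pos_zero n) (Fpoly n) = 1"
    using simple_zero_Fpoly[of m "pos_zero n"] simple_zero_Fpoly[of m "- pos_zero n"]
      pos_zero_Fpoly(3)[OF assms] by (simp_all add: Fpoly_reflect_eq_0 flip: n)
qed

section \<open>Cosine series\<close>

text \<open>
Multiplying by \<open>2 cos (x / 2)\<close> makes the sum telescope.
\<close>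

lemma alternating_dirichlet_kernel:
  fixes x :: real
  shows "(\<Sum>k<K. (-1) ^ Suc k * cos (real (Suc k) * x)) * (2 * cos (x / 2))
    = - cos (x / 2) + (-1) ^ K * cos ((real K + 1 / 2) * x)"
proof (induction K)
  case 0
  then show ?case by simp
next
  case (Suc K)
  have "2 * cos (real (Suc K) * x) * cos (x / 2)
      = cos (real (Suc K) * x - x / 2) + cos (real (Suc K) * x + x / 2)"
    by (simp only: cos_add cos_diff)
  also have "real (Suc K) * x - x / 2 = (real K + 1 / 2) * x" by (simp add: algebra_simps)
  also have "real (Suc K) * x + x / 2 = (real (Suc K) + 1 / 2) * x" by (simp add: algebra_simps)
  finally have "2 * cos (real (Suc K) * x) * cos (x / 2)
      = cos ((real K + 1 / 2) * x) + cos ((real (Suc K) + 1 / 2) * x)" .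
  then have "(-1) ^ Suc K * (2 * cos (real (Suc K) * x) * cos (x / 2))
      = - ((-1) ^ K * cos ((real K + 1 / 2) * x)) + (-1) ^ Suc K * cos ((real (Suc K) + 1 / 2) * x)"
    by (simp add: distrib_left del: of_nat_Suc)
  with Suc show ?case by (simp add: algebra_simps del: of_nat_Suc power_Suc)
qed

text \<open>
Convergence of the sawtooth series \<open>\<Sum> (-1)\<^sup>j sin(j y) / j = - y / 2\<close> at rate \<open>1 / K\<close>, uniformly on
\<open>[0, x]\<close> with \<open>x < \<pi>\<close>.  The derivative of the error is the oscillating kernel
\<open>\<plusminus> cos(M y) / (2 cos(y / 2))\<close> with \<open>M = K + 1/2\<close>; one integration by parts gains the factor
\<open>1 / M\<close>.  In the proof, \<open>B\<close> is the boundary term and \<open>G'\<close> the remaining integrand.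
\<close>

lemma sawtooth_partial_sum_bound:
  assumes "0 \<le> y" "y \<le> x" "x < pi"
  shows "\<bar>(\<Sum>k<K. (-1) ^ Suc k * sin (real (Suc k) * y) / real (Suc k)) + y / 2\<bar>
    \<le> (x / (4 * (cos (x / 2))\<^sup>2) + 1 / (2 * cos (x / 2))) / (real K + 1 / 2)"
proof -
  define M where "M = real K + 1 / 2"
  define m where "m = cos (x / 2)"
  define S where "S y = (\<Sum>k<K. (-1) ^ Suc k * sin (real (Suc k) * y) / real (Suc k))" for y
  define B where "B y = (-1) ^ K * sin (M * y) / (2 * M * cos (y / 2))" for y
  have M: "0 < M" by (simp add: M_def)
  have m: "0 < m" using assms by (auto simp: m_def intro!: cos_gt_zero_pi)
  have cos_ge: "m \<le> cos (z / 2)" if "0 \<le> z" "z \<le> x" for z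
    using that assms by (auto simp: m_def intro!: cos_monotone_0_pi_le)
  have B: "\<bar>B z\<bar> \<le> 1 / (2 * m) / M" if "0 \<le> z" "z \<le> x" for z
  proof -
    have "\<bar>B z\<bar> \<le> 1 / (2 * M * cos (z / 2))"
      using M m cos_ge[OF that] by (auto simp: B_def abs_mult power_abs divide_right_mono)
    also have "\<dots> \<le> 1 / (2 * M * m)"
      using M m cos_ge[OF that] by (intro divide_left_mono mult_left_mono mult_pos_pos) auto
    finally show ?thesis by (simp add: field_simps)
  qed
  define G where "G z = S z + z / 2 - B z" for z
  define G' where "G' z = - ((-1) ^ K * sin (M * z) * sin (z / 2) / (4 * M * (cos (z / 2))\<^sup>2))" for z
  have S': "(S has_real_derivative (\<Sum>k<K. (-1) ^ Suc k * cos (real (Suc k) * z))) (at z)" for z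
    unfolding S_def
    by (auto intro!: derivative_eq_intros sum.cong simp del: of_nat_Suc power_Suc)
  have G': "(G has_real_derivative G' z) (at z)" if "0 \<le> z" "z \<le> x" for z
  proof -
    have c: "0 < cos (z / 2)" using cos_ge[OF that] m by linarith
    have kernel: "(\<Sum>k<K. (-1) ^ Suc k * cos (real (Suc k) * z)) =
        - 1 / 2 + (-1) ^ K * cos (M * z) / (2 * cos (z / 2))"
      using alternating_dirichlet_kernel[of z K] c by (simp add: M_def field_simps del: of_nat_Suc power_Suc)
    have B': "(B has_real_derivative ((-1) ^ K * cos (M * z) / (2 * cos (z / 2))
          + (-1) ^ K * sin (M * z) * sin (z / 2) / (4 * M * (cos (z / 2))\<^sup>2))) (at z)"
      unfolding B_def using M c
      by (auto intro!: derivative_eq_intros simp: field_simps power2_eq_square)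
    have half: "((\<lambda>z. z / 2) has_real_derivative 1 / 2) (at z)"
      by (auto intro!: derivative_eq_intros)
    show ?thesis
      using DERIV_diff[OF DERIV_add[OF S'[of z] half] B'] unfolding kernel G_def G'_def by simp
  qed
  have G'_bound: "\<bar>G' z\<bar> \<le> 1 / (4 * M * m\<^sup>2)" if "0 \<le> z" "z \<le> x" for z
  proof -
    have "m\<^sup>2 \<le> (cos (z / 2))\<^sup>2" using cos_ge[OF that] m by (intro power_mono) auto
    moreover have "\<bar>sin (M * z)\<bar> * \<bar>sin (z / 2)\<bar> \<le> 1 * 1" by (intro mult_mono) auto
    ultimately have "\<bar>sin (M * z)\<bar> * \<bar>sin (z / 2)\<bar> / (4 * M * (cos (z / 2))\<^sup>2) \<le> 1 / (4 * M * m\<^sup>2)"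
      using M m by (intro frac_le mult_left_mono mult_pos_pos) auto
    then show ?thesis using M by (simp add: G'_def abs_mult power_abs)
  qed
  have "\<bar>G y\<bar> \<le> x / (4 * m\<^sup>2) / M"
  proof (cases "y = 0")
    case True
    then show ?thesis using assms M m by (simp add: G_def S_def B_def)
  next
    case False
    then have "0 < y" using assms by simp
    then obtain z where z: "0 < z" "z < y" "G y - G 0 = (y - 0) * G' z"
      using MVT2[of 0 y G G'] G' assms by auto
    then have "\<bar>G y\<bar> = y * \<bar>G' z\<bar>" using assms by (simp add: G_def S_def B_def abs_mult)
    also have "\<dots> \<le> x * (1 / (4 * M * m\<^sup>2))"
      using G'_bound[of z] z assms by (intro mult_mono) auto
    finally show ?thesis by (simp add: field_simps)
  qed
  moreover have "S y + y / 2 = G y + B y" by (simp add: G_def)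
  ultimately have "\<bar>S y + y / 2\<bar> \<le> x / (4 * m\<^sup>2) / M + 1 / (2 * m) / M"
    using B[of y] assms by linarith
  then show ?thesis by (simp add: S_def M_def m_def add_divide_distrib)
qed

text \<open>
The alternating series \<open>\<Sum>\<^bsub>j\<ge>1\<^esub> (-1)\<^sup>j cos(j x) / j\<^sup>N\<close>; the summation index is \<open>j = k + 1\<close>.
\<close>

definition alt_cos_series :: "nat \<Rightarrow> real \<Rightarrow> real" where
  "alt_cos_series N x = (\<Sum>k. (-1) ^ Suc k * cos (real (Suc k) * x) / real (Suc k) ^ N)"

definition alt_sin_series :: "nat \<Rightarrow> real \<Rightarrow> real" where
  "alt_sin_series N x = (\<Sum>k. (-1) ^ Suc k * sin (real (Suc k) * x) / real (Suc k) ^ N)"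

lemma summable_power_Suc: "2 \<le> N \<Longrightarrow> summable (\<lambda>k. 1 / real (Suc k) ^ N)"
  using inverse_power_summable[of N, where 'a = real]
  by (subst summable_Suc_iff[of "\<lambda>k. 1 / real k ^ N"]) (simp add: inverse_eq_divide)

lemma trig_term_bound: "\<bar>c\<bar> \<le> 1 \<Longrightarrow> norm ((-1) ^ Suc k * c / real (Suc k) ^ N) \<le> 1 / real (Suc k) ^ N"
  by (simp add: abs_mult power_abs divide_right_mono del: of_nat_Suc)

lemma summable_alt_cos_series: "2 \<le> N \<Longrightarrow> summable (\<lambda>k. (-1) ^ Suc k * cos (real (Suc k) * x) / real (Suc k) ^ N)"
  by (rule summable_comparison_test'[OF summable_power_Suc[of N], of 0])
      (assumption, rule trig_term_bound, simp)

lemma DERIV_alt_sin_series: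
  assumes "2 \<le> N"
  shows "(alt_sin_series (Suc N) has_real_derivative alt_cos_series N x) (at x)"
  unfolding alt_sin_series_def alt_cos_series_def
proof (rule has_field_derivative_series'(2)[where S = UNIV and ?x0.0 = 0])
  fix k :: nat and y :: real
  show "((\<lambda>x. (-1) ^ Suc k * sin (real (Suc k) * x) / real (Suc k) ^ Suc N) has_field_derivative
      (-1) ^ Suc k * cos (real (Suc k) * y) / real (Suc k) ^ N) (at y within UNIV)"
    by (auto intro!: derivative_eq_intros simp del: of_nat_Suc power_Suc simp: power_Suc[of _ N])
next
  show "uniformly_convergent_on UNIV (\<lambda>n x. \<Sum>k<n. (-1) ^ Suc k * cos (real (Suc k) * x) / real (Suc k) ^ N)"
    by (rule Weierstrass_m_test'[OF _ summable_power_Suc[OF assms]]) (rule trig_term_bound, simp)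
qed auto

lemma DERIV_alt_cos_series:
  assumes "2 \<le> N"
  shows "(alt_cos_series (Suc N) has_real_derivative - alt_sin_series N x) (at x)"
proof -
  have s: "summable (\<lambda>k. (-1) ^ Suc k * sin (real (Suc k) * x) / real (Suc k) ^ N)"
    by (rule summable_comparison_test'[OF summable_power_Suc[OF assms], of 0]) (rule trig_term_bound, simp)
  have "(alt_cos_series (Suc N) has_real_derivative
      (\<Sum>k. - ((-1) ^ Suc k * sin (real (Suc k) * x) / real (Suc k) ^ N))) (at x)"
    unfolding alt_cos_series_def
  proof (rule has_field_derivative_series'(2)[where S = UNIV and ?x0.0 = 0])
    fix k :: nat and y :: real
    show "((\<lambda>x. (-1) ^ Suc k * cos (real (Suc k) * x) / real (Suc k) ^ Suc N) has_field_derivative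
        - ((-1) ^ Suc k * sin (real (Suc k) * y) / real (Suc k) ^ N)) (at y within UNIV)"
      by (auto intro!: derivative_eq_intros simp del: of_nat_Suc power_Suc simp: power_Suc[of _ N])
  next
    show "uniformly_convergent_on UNIV (\<lambda>n x. \<Sum>k<n.
        - ((-1) ^ Suc k * sin (real (Suc k) * x) / real (Suc k) ^ N))"
      by (rule Weierstrass_m_test'[OF _ summable_power_Suc[OF assms]])
         (subst norm_minus_cancel, rule trig_term_bound, simp)
    show "summable (\<lambda>k. (-1) ^ Suc k * cos (real (Suc k) * 0) / real (Suc k) ^ Suc N)"
      using assms by (intro summable_alt_cos_series) auto
  qed auto
  with suminf_minus[OF s] show ?thesis by (simp add: alt_sin_series_def)
qed

lemma alt_sin_series_0: "alt_sin_series N 0 = 0" by (simp add: alt_sin_series_def)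

lemma alt_sin_series_pi: "alt_sin_series N pi = 0"
  by (simp add: alt_sin_series_def del: of_nat_Suc)

text \<open>
The partial sums differ from \<open>x\<^sup>2 / 4\<close> by functions whose derivatives tend to \<open>0\<close> uniformly on
\<open>[0, x]\<close>, by the sawtooth bound.
\<close>

lemma alt_cos_series_2:
  assumes "0 \<le> x" "x < pi"
  shows "alt_cos_series 2 x = x\<^sup>2 / 4 + alt_cos_series 2 0"
proof (cases "x = 0")
  case False
  then have x: "0 < x" using assms by simp
  define C where "C = x / (4 * (cos (x / 2))\<^sup>2) + 1 / (2 * cos (x / 2))"
  define T where "T K y = (\<Sum>k<K. (-1) ^ Suc k * cos (real (Suc k) * y) / real (Suc k) ^ 2) - y\<^sup>2 / 4" for K y
  have lim: "(\<lambda>K. T K y) \<longlonglongrightarrow> alt_cos_series 2 y - y\<^sup>2 / 4" for y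
    unfolding T_def alt_cos_series_def by (intro tendsto_diff summable_LIMSEQ summable_alt_cos_series) auto
  have bound: "\<bar>T K x - T K 0\<bar> \<le> x * (C / (real K + 1 / 2))" for K
  proof -
    define T' where "T' y = - ((\<Sum>k<K. (-1) ^ Suc k * sin (real (Suc k) * y) / real (Suc k)) + y / 2)" for y
    have "(T K has_real_derivative T' y) (at y)" for y
      unfolding T_def T'_def
      by (auto intro!: derivative_eq_intros simp del: of_nat_Suc power_Suc
          simp: sum_negf[symmetric] power2_eq_square intro!: sum.cong)
    then obtain z where z: "0 < z" "z < x" "T K x - T K 0 = (x - 0) * T' z"
      using MVT2[OF x, of "T K" T'] by auto
    have "\<bar>T' z\<bar> \<le> C / (real K + 1 / 2)"
      using sawtooth_partial_sum_bound[of z x K] z assms unfolding T'_def C_def abs_minus_cancel by simp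
    then have "x * \<bar>T' z\<bar> \<le> x * (C / (real K + 1 / 2))" using x by (intro mult_left_mono) auto
    then show ?thesis using z x by (simp only: abs_mult diff_0_right)
  qed
  have "(\<lambda>K. x * (C / (real K + 1 / 2))) \<longlonglongrightarrow> 0"
  proof -
    have "filterlim (\<lambda>K. 1 / 2 + real K) at_top sequentially"
      by (rule filterlim_tendsto_add_at_top[OF tendsto_const filterlim_real_sequentially])
    then show ?thesis
      by (intro tendsto_mult_right_zero tendsto_divide_0[OF tendsto_const] filterlim_at_top_imp_at_infinity)
         (simp add: add.commute)
  qed
  then have "(\<lambda>K. T K x - T K 0) \<longlonglongrightarrow> 0"
    by (rule Lim_null_comparison[OF always_eventually, rotated]) (simp only: real_norm_def bound simp_thms)
  moreover have "(\<lambda>K. T K x - T K 0) \<longlonglongrightarrow> (alt_cos_series 2 x - x\<^sup>2 / 4) - (alt_cos_series 2 0 - 0\<^sup>2 / 4)"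
    by (intro tendsto_diff lim)
  ultimately have "(alt_cos_series 2 x - x\<^sup>2 / 4) - (alt_cos_series 2 0 - 0\<^sup>2 / 4) = 0" using LIMSEQ_unique
      by blast
  then show ?thesis by simp
qed simp

text \<open>
If \<open>F\<^sub>n\<close> is known up to a constant \<open>c\<close> on \<open>(0, 1)\<close>, integration shows that \<open>F\<^bsub>n+1\<^esub>\<close> is \<open>B\<close> plus
\<open>c t\<close>; both \<open>F\<^bsub>n+1\<^esub>\<close> and \<open>B\<close> vanish at \<open>0\<close> and \<open>1\<close>, so \<open>c = 0\<close>.
\<close>

lemma Fpoly_odd_constant_of_integration:
  assumes F: "\<And>t. 0 < t \<Longrightarrow> t < 1 \<Longrightarrow> poly (Fpoly n) t = A t + c" and "odd n"
    and B: "\<And>t. (B has_real_derivative A t) (at t)" "B 0 = 0" "B 1 = 0"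
  shows "c = 0"
proof -
  define D where "D t = poly (Fpoly (Suc n)) t - B t - c * t" for t
  have D': "(D has_real_derivative (poly (Fpoly n) t - A t - c)) (at t)" for t
    unfolding D_def by (auto intro!: derivative_eq_intros B simp: pderiv_Fpoly)
  have "D 1 = D 0"
  proof (rule DERIV_isconst_end[where f = D])
    show "continuous_on {0..1} D" using D' by (meson DERIV_continuous continuous_at_imp_continuous_on)
    show "(D has_real_derivative 0) (at s)" if "0 < s" "s < 1" for s
      using D'[of s] F[OF that] by simp
  qed simp
  then show "c = 0" using Fpoly_even_zeros[of "Suc n"] assms by (simp add: D_def)
qed

text \<open>
The Fourier expansion of the Bernoulli polynomials.  It starts from \<open>F\<^sub>1 = t\<^sup>2 / 2 - 1 / 6\<close> and is
integrated twice per step.  The constant at the even index is fixed by the value \<open>0\<close> at \<open>t = 0\<close>,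
the one at the odd index by \<open>Fpoly_odd_constant_of_integration\<close>.
\<close>

lemma Fpoly_fourier:
  "0 < t \<Longrightarrow> t < 1 \<Longrightarrow>
    poly (Fpoly (2 * m + 1)) t = (-1) ^ m * 2 / pi ^ (2 * m + 2) * alt_cos_series (2 * m + 2) (pi * t)"
proof (induction m arbitrary: t)
  case 0
  define c where "c = poly (Fpoly 1) 0 - 2 / pi\<^sup>2 * alt_cos_series 2 0"
  have eq: "poly (Fpoly 1) t = 2 / pi\<^sup>2 * alt_cos_series 2 (pi * t) + c" if t: "0 < t" "t < 1" for t
  proof -
    define D where "D t = poly (Fpoly 1) t - t\<^sup>2 / 2" for t
    have "(D has_real_derivative 0) (at t)" for t
      unfolding D_def by (auto intro!: derivative_eq_intros simp: Fpoly_0 pderiv_Fpoly[of 0, simplified])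
    then have "D t = D 0" using DERIV_isconst_all by blast
    moreover have "alt_cos_series 2 (pi * t) = (pi * t)\<^sup>2 / 4 + alt_cos_series 2 0"
      using t by (intro alt_cos_series_2) auto
    ultimately show ?thesis by (simp add: D_def c_def power_mult_distrib algebra_simps)
  qed
  have "((\<lambda>t. 2 / pi ^ 3 * alt_sin_series 3 (pi * t)) has_real_derivative 2 / pi\<^sup>2 *
      alt_cos_series 2 (pi * t)) (at t)" for t
    using DERIV_chain2[OF DERIV_alt_sin_series[of 2 "pi * t"] DERIV_cmult_Id[of pi]]
    by (auto intro!: derivative_eq_intros simp: numeral_3_eq_3 numeral_2_eq_2)
  then have "c = 0"
    by (intro Fpoly_odd_constant_of_integration[where B =
        "\<lambda>t. 2 / pi ^ 3 * alt_sin_series 3 (pi * t)", OF eq]) (auto simp: alt_sin_series_0 alt_sin_series_pi)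
  with eq 0 show ?case by (simp add: numeral_2_eq_2)
next
  case (Suc m)
  define n where "n = 2 * m + 1"
  define a where "a = (-1) ^ m * 2 / pi ^ (n + 1)"
  have IH: "poly (Fpoly n) t = a * alt_cos_series (n + 1) (pi * t)" if "0 < t" "t < 1" for t
    using Suc.IH[OF that] by (simp add: n_def a_def)
  have dsin: "((\<lambda>t. alt_sin_series (N + 1) (pi * t)) has_real_derivative pi * alt_cos_series N (pi * t))
      (at t)" if "2 \<le> N" for N t
    using DERIV_chain2[OF DERIV_alt_sin_series[OF that, of "pi * t"] DERIV_cmult_Id[of pi]]
        by (simp add: mult.commute)
  have dcos: "((\<lambda>t. alt_cos_series (N + 1) (pi * t)) has_real_derivative - (pi * alt_sin_series N (pi * t)))
      (at t)" if "2 \<le> N" for N t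
    using DERIV_chain2[OF DERIV_alt_cos_series[OF that, of "pi * t"] DERIV_cmult_Id[of pi]]
        by (simp add: mult.commute)
  have F1: "poly (Fpoly (n + 1)) t = a / pi * alt_sin_series (n + 2) (pi * t)" if t: "0 < t" "t < 1" for t
  proof -
    define D where "D t = poly (Fpoly (n + 1)) t - a / pi * alt_sin_series (n + 2) (pi * t)" for t
    have D': "(D has_real_derivative (poly (Fpoly n) t - a * alt_cos_series (n + 1) (pi * t))) (at t)" for t
      unfolding D_def using dsin[of "n + 1" t]
      by (auto intro!: derivative_eq_intros simp: n_def pderiv_Fpoly)
    have "D t = D 0"
    proof (rule DERIV_isconst_end[where f = D])
      show "continuous_on {0..t} D" using D' by (meson DERIV_continuous continuous_at_imp_continuous_on)
      show "(D has_real_derivative 0) (at s)" if "0 < s" "s < t" for s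
        using D'[of s] IH[of s] that t by simp
    qed (use t in auto)
    then show ?thesis using Fpoly_even_zeros[of "n + 1"] by (simp add: D_def alt_sin_series_0 n_def)
  qed
  define b where "b = - a / pi\<^sup>2"
  define D where "D t = poly (Fpoly (n + 2)) t - b * alt_cos_series (n + 3) (pi * t)" for t
  have D': "(D has_real_derivative (poly (Fpoly (n + 1)) t - a / pi * alt_sin_series (n + 2) (pi * t)))
      (at t)" for t
    unfolding D_def b_def using dcos[of "n + 2" t]
    by (auto intro!: derivative_eq_intros simp: n_def pderiv_Fpoly power2_eq_square numeral_3_eq_3)
  have eq: "poly (Fpoly (n + 2)) t = b * alt_cos_series (n + 3) (pi * t) + D 0" if t: "0 < t" "t < 1" for t
  proof -
    have "D t = D 0"
    proof (rule DERIV_isconst_end[where f = D])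
      show "continuous_on {0..t} D" using D' by (meson DERIV_continuous continuous_at_imp_continuous_on)
      show "(D has_real_derivative 0) (at s)" if "0 < s" "s < t" for s
        using D'[of s] F1[of s] that t by simp
    qed (use t in auto)
    then show ?thesis by (simp add: D_def)
  qed
  have "((\<lambda>t. b / pi * alt_sin_series (n + 4) (pi * t)) has_real_derivative b * alt_cos_series (n + 3)
      (pi * t)) (at t)" for t
    using dsin[of "n + 3" t] by (auto intro!: derivative_eq_intros simp: add.commute)
  then have "D 0 = 0"
    by (intro Fpoly_odd_constant_of_integration[where B =
        "\<lambda>t. b / pi * alt_sin_series (n + 4) (pi * t)", OF eq])
       (auto simp: alt_sin_series_0 alt_sin_series_pi n_def)
  moreover have "b = (-1) ^ Suc m * 2 / pi ^ (2 * Suc m + 2)"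
    by (simp add: b_def a_def n_def power2_eq_square)
  ultimately show ?case using eq[OF Suc.prems] by (simp add: n_def numeral_3_eq_3)
qed

section \<open>Asymptotics of the positive zero\<close>

lemma abs_sin_minus_self_le: "\<bar>sin x - x\<bar> \<le> \<bar>x :: real\<bar> ^ 3 / 6"
  using Maclaurin_sin_bound[of x 3] by (simp add: sin_coeff_def eval_nat_numeral)

lemma abs_sin_minus_cubic_le: "\<bar>sin x - x + x ^ 3 / 6\<bar> \<le> \<bar>x :: real\<bar> ^ 5"
proof -
  have "(\<Sum>m<5. sin_coeff m * x ^ m) = x - x ^ 3 / 6"
  proof -
    have "(\<Sum>m<5. g m) = g 0 + g 1 + g 2 + g 3 + g 4" for g :: "nat \<Rightarrow> real"
      by (simp add: eval_nat_numeral)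
    then show ?thesis by (simp add: sin_coeff_def fact_numeral)
  qed
  then have "\<bar>sin x - x + x ^ 3 / 6\<bar> \<le> inverse (fact 5) * \<bar>x\<bar> ^ 5"
    using Maclaurin_sin_bound[of x 5] by (simp add: algebra_simps)
  also have "\<dots> \<le> 1 * \<bar>x\<bar> ^ 5" by (intro mult_right_mono) (auto simp: fact_numeral)
  finally show ?thesis by simp
qed

lemma abs_cos_minus_one_le: "\<bar>cos x - 1\<bar> \<le> \<bar>x :: real\<bar> ^ 2"
proof -
  obtain t where "cos x = (\<Sum>m<2. cos_coeff m * x ^ m) + (cos (t + 1 / 2 * real 2 * pi) / fact 2) * x ^ 2"
    using Maclaurin_cos_expansion[of x 2] by blast
  then have "cos x - 1 = (cos (t + 1 / 2 * real 2 * pi) / 2) * x ^ 2"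
    by (simp add: cos_coeff_def eval_nat_numeral)
  moreover have "\<bar>cos (t + 1 / 2 * real 2 * pi) / 2\<bar> \<le> 1" using abs_cos_le_one[of "t + 1 / 2 * real 2 * pi"]
      by linarith
  ultimately show ?thesis by (metis abs_mult mult_left_le_one_le power_abs abs_ge_zero)
qed

lemma abs_cos_minus_quadratic_le: "\<bar>cos x - 1 + x ^ 2 / 2\<bar> \<le> \<bar>x :: real\<bar> ^ 4"
proof -
  obtain t where "cos x = (\<Sum>m<4. cos_coeff m * x ^ m) + (cos (t + 1 / 2 * real 4 * pi) / fact 4) * x ^ 4"
    using Maclaurin_cos_expansion[of x 4] by blast
  then have "cos x - 1 + x ^ 2 / 2 = (cos (t + 1 / 2 * real 4 * pi) / 24) * x ^ 4"
  proof -
    have "(\<Sum>m<4. g m) = g 0 + g 1 + g 2 + g 3" for g :: "nat \<Rightarrow> real"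
      by (simp add: eval_nat_numeral)
    moreover assume "cos x = (\<Sum>m<4. cos_coeff m * x ^ m) + (cos (t + 1 / 2 * real 4 * pi) / fact 4) * x ^ 4"
    ultimately show ?thesis by (simp add: cos_coeff_def fact_numeral)
  qed
  moreover have "\<bar>cos (t + 1 / 2 * real 4 * pi) / 24\<bar> \<le> 1"
      using abs_cos_le_one[of "t + 1 / 2 * real 4 * pi"] by linarith
  ultimately show ?thesis by (metis abs_mult mult_left_le_one_le power_abs abs_ge_zero)
qed

text \<open>
A crude form of Jordan's inequality, from \<open>\<bar>sin x - x\<bar> \<le> \<bar>x\<bar>\<^sup>3 / 6\<close> and \<open>\<pi> < 4\<close>.
\<close>

lemma abs_le_abs_sin:
  assumes "\<bar>x\<bar> \<le> pi / 2"
  shows "\<bar>x\<bar> \<le> 3 * \<bar>sin x\<bar>"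
proof -
  have "\<bar>x\<bar> \<le> 2" using assms pi_less_4 by linarith
  then have "\<bar>x\<bar> ^ 2 \<le> 2 ^ 2" by (intro power_mono) auto
  then have "\<bar>x\<bar> ^ 2 * \<bar>x\<bar> \<le> 4 * \<bar>x\<bar>" by (intro mult_right_mono) auto
  then have "\<bar>x\<bar> ^ 3 \<le> 4 * \<bar>x\<bar>" by (simp add: eval_nat_numeral)
  then show ?thesis using abs_sin_minus_self_le[of x] by linarith
qed

text \<open>
From the tenth term on, \<open>j\<^bsup>-N\<^esup> \<le> 10\<^bsup>-N\<^esup> (10 / j)\<^sup>2\<close>, so the tail is \<open>O(10\<^bsup>-N\<^esup>)\<close> uniformly in \<open>x\<close>.
\<close>

lemma alt_cos_series_tail:
  "\<exists>C. \<forall>N\<ge>2. \<forall>x. \<bar>alt_cos_series N x - (\<Sum>k<9. (-1) ^ Suc k * cos (real (Suc k) * x) / real (Suc k) ^ N)\<bar>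
      \<le> C / 10 ^ N"
proof (intro exI allI impI)
  fix N :: nat and x :: real assume N: "2 \<le> N"
  define f where "f k = (-1) ^ Suc k * cos (real (Suc k) * x) / real (Suc k) ^ N" for k
  have "alt_cos_series N x - (\<Sum>k<9. f k) = (\<Sum>k. f (k + 9))"
    using suminf_split_initial_segment[OF summable_alt_cos_series[OF N, of x], of 9]
        unfolding alt_cos_series_def f_def by linarith
  also have "\<bar>\<dots>\<bar> \<le> (\<Sum>k. 1 / 10 ^ N * (100 * (1 / real (Suc k) ^ 2)))"
  proof (rule norm_suminf_le[where 'a = real, simplified real_norm_def])
    fix k
    have "\<bar>f (k + 9)\<bar> \<le> 1 / real (Suc (k + 9)) ^ N"
      using trig_term_bound[of "cos (real (Suc (k + 9)) * x)" "k + 9" N]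
          by (simp add: f_def del: of_nat_Suc power_Suc)
    also have "\<dots> = 1 / 10 ^ N * (10 / real (k + 10)) ^ N"
      by (simp add: power_divide add.commute)
    also have "(10 / real (k + 10)) ^ N \<le> (10 / real (k + 10)) ^ 2"
      using N by (intro power_decreasing) auto
    also have "\<dots> \<le> (10 / real (Suc k)) ^ 2"
      by (intro power_mono divide_left_mono) auto
    also have "\<dots> = 100 * (1 / real (Suc k) ^ 2)"
      by (simp add: power_divide)
    finally show "\<bar>f (k + 9)\<bar> \<le> 1 / 10 ^ N * (100 * (1 / real (Suc k) ^ 2))"
      by (simp add: mult_left_mono divide_right_mono)
  next
    show "summable (\<lambda>k. 1 / 10 ^ N * (100 * (1 / real (Suc k) ^ 2)))"
      by (intro summable_mult summable_power_Suc) simp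
  qed
  also have "\<dots> = 1 / 10 ^ N * (\<Sum>k. 100 * (1 / real (Suc k) ^ 2))"
    by (intro suminf_mult summable_mult summable_power_Suc) simp
  finally show "\<bar>alt_cos_series N x - (\<Sum>k<9. (-1) ^ Suc k * cos (real (Suc k) * x) / real (Suc k) ^ N)\<bar>
      \<le> (\<Sum>k. 100 * (1 / real (Suc k) ^ 2)) / 10 ^ N"
    by (simp add: f_def)
qed

text \<open>
The shift by \<open>\<pi> / 2\<close> corresponds to measuring the zero of \<open>F\<^sub>n\<close> from \<open>t = 1/2\<close>.
\<close>

lemma cos_multiples_shifted:
  fixes \<theta> :: real
  defines "x \<equiv> \<theta> + pi / 2"
  shows "(\<Sum>k<9. (-1) ^ Suc k * cos (real (Suc k) * x) / real (Suc k) ^ N) =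
    sin \<theta> - cos (2 * \<theta>) / 2 ^ N - sin (3 * \<theta>) / 3 ^ N + cos (4 * \<theta>) / 4 ^ N + sin (5 * \<theta>) / 5 ^ N
    - cos (6 * \<theta>) / 6 ^ N - sin (7 * \<theta>) / 7 ^ N + cos (8 * \<theta>) / 8 ^ N + sin (9 * \<theta>) / 9 ^ N"
proof -
  have half: "cos (y + pi / 2) = - sin y" for y :: real by (simp add: cos_add)
  have "2 * x = 2 * \<theta> + pi" "3 * x = (3 * \<theta> + pi / 2) + pi" "4 * x = 4 * \<theta> + 2 * pi"
    "5 * x = (5 * \<theta> + pi / 2) + 2 * pi" "6 * x = (6 * \<theta> + pi) + 2 * pi"
    "7 * x = ((7 * \<theta> + pi / 2) + pi) + 2 * pi" "8 * x = (8 * \<theta> + 2 * pi) + 2 * pi"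
    "9 * x = ((9 * \<theta> + pi / 2) + 2 * pi) + 2 * pi"
    by (simp_all add: x_def algebra_simps)
  then have c: "cos x = - sin \<theta>" "cos (2 * x) = - cos (2 * \<theta>)" "cos (3 * x) = sin (3 * \<theta>)"
      "cos (4 * x) = cos (4 * \<theta>)"
    "cos (5 * x) = - sin (5 * \<theta>)" "cos (6 * x) = - cos (6 * \<theta>)" "cos (7 * x) = sin (7 * \<theta>)"
        "cos (8 * x) = cos (8 * \<theta>)"
    "cos (9 * x) = - sin (9 * \<theta>)"
    by (simp_all only: cos_periodic cos_periodic_pi half minus_minus) (simp add: x_def half)
  have "(\<Sum>k<9. g k) = g 0 + g 1 + g 2 + g 3 + g 4 + g 5 + g 6 + g 7 + g 8" for g :: "nat \<Rightarrow> real"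
    by (simp add: eval_nat_numeral)
  then show ?thesis by (simp add: c)
qed

text \<open>
The scale \<open>b\<^bsup>-(n+1)\<^esup>\<close>.  It is multiplicative in \<open>b\<close>, so orders of magnitude in the expansion are
tracked by multiplying bases.
\<close>

definition decay :: "real \<Rightarrow> nat \<Rightarrow> real" where
  "decay b n = 1 / b ^ (n + 1)"

lemma decay_mult: "decay b n * decay c n = decay (b * c) n"
  by (simp add: decay_def power_mult_distrib)

lemma bigo_decay_mono:
  assumes "f \<in> O[F](decay b)" "0 < c" "c \<le> b"
  shows "f \<in> O[F](decay c)"
proof (rule landau_o.big.trans[OF assms(1)], rule landau_o.bigI[of 1])
  have "norm (decay b n) \<le> 1 * norm (decay c n)" for n
    using assms by (auto simp: decay_def intro!: divide_left_mono power_mono mult_mono)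
  then show "\<forall>\<^sub>F n in F. norm (decay b n) \<le> 1 * norm (decay c n)" by simp
qed simp

lemma bigo_decay_mult:
  assumes "f \<in> O[F](decay b)" "g \<in> O[F](decay c)"
  shows "(\<lambda>n. f n * g n) \<in> O[F](decay (b * c))"
  using landau_o.big.mult[OF assms] by (simp add: decay_mult)

lemma bigo_decay_compose:
  assumes "\<theta> \<in> O[F](decay b)" and f: "\<And>x. \<bar>f x\<bar> \<le> C * \<bar>x\<bar> ^ j" and "c = b ^ j"
  shows "(\<lambda>n. f (\<theta> n)) \<in> O[F](decay c)"
proof -
  have "(\<lambda>n. f (\<theta> n)) \<in> O[F](\<lambda>n. \<theta> n ^ j)"
  proof (intro landau_o.bigI[of "max C 1"] always_eventually allI)
    fix n
    have "\<bar>f (\<theta> n)\<bar> \<le> C * \<bar>\<theta> n\<bar> ^ j" by (rule f)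
    also have "\<dots> \<le> max C 1 * \<bar>\<theta> n\<bar> ^ j" by (intro mult_right_mono) auto
    finally show "norm (f (\<theta> n)) \<le> max C 1 * norm (\<theta> n ^ j)" by (simp add: power_abs)
  qed simp
  also have "(\<lambda>n. \<theta> n ^ j) \<in> O[F](\<lambda>n. decay b n ^ j)"
    by (intro landau_o.big_power assms)
  also have "(\<lambda>n. decay b n ^ j) = decay c"
    by (rule ext) (simp only: decay_def assms(3) power_divide power_one power_mult[symmetric] mult.commute)
  finally show ?thesis .
qed

text \<open>
The first nine harmonics of the cosine series at the positive zero of \<open>F\<^sub>n\<close>.
\<close>

lemma pos_zero_equation:
  fixes \<theta> :: "nat \<Rightarrow> real"
  defines "\<theta> \<equiv> (\<lambda>n. pi * (pos_zero n - 1 / 2))"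
  shows "\<exists>C. \<forall>n. odd n \<longrightarrow> \<bar>\<theta> n\<bar> \<le> pi / 2 \<and>
    \<bar>sin (\<theta> n) - cos (2 * \<theta> n) * decay 2 n
        - sin (3 * \<theta> n) * decay 3 n + cos (4 * \<theta> n) * decay 4 n + sin (5 * \<theta> n) * decay 5 n
     - cos (6 * \<theta> n) * decay 6 n - sin (7 * \<theta> n) * decay 7 n + cos (8 * \<theta> n) * decay 8 n + sin (9 * \<theta> n) *
         decay 9 n\<bar> \<le> C * decay 10 n"
proof -
  obtain C where C: "\<And>N x. 2 \<le> N \<Longrightarrow>
      \<bar>alt_cos_series N x - (\<Sum>k<9. (-1) ^ Suc k * cos (real (Suc k) * x) / real (Suc k) ^ N)\<bar> \<le> C / 10 ^ N"
    using alt_cos_series_tail by blast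
  show ?thesis
  proof (intro exI allI impI conjI)
    fix n :: nat assume n: "odd n"
    then obtain m where m: "n = 2 * m + 1" by (elim oddE)
    note z = pos_zero_Fpoly[OF n]
    have "\<bar>pos_zero n - 1 / 2\<bar> \<le> 1 / 2" using z(1,2) by linarith
    then have "pi * \<bar>pos_zero n - 1 / 2\<bar> \<le> pi * (1 / 2)" by (intro mult_left_mono) auto
    then show "\<bar>\<theta> n\<bar> \<le> pi / 2" by (simp add: \<theta>_def abs_mult)
    have "alt_cos_series (n + 1) (pi * pos_zero n) = 0"
      using Fpoly_fourier[of "pos_zero n" m] z(1-3) by (simp add: m)
    moreover have "pi * pos_zero n = \<theta> n + pi / 2" by (simp add: \<theta>_def algebra_simps)
    ultimately have "\<bar>\<Sum>k<9. (-1) ^ Suc k * cos (real (Suc k) * (\<theta> n + pi / 2)) / real (Suc k) ^ (n + 1)\<bar>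
        \<le> C / 10 ^ (n + 1)"
      using C[of "n + 1" "\<theta> n + pi / 2"] by (simp only: m) simp
    then show "\<bar>sin (\<theta> n) - cos (2 * \<theta> n) * decay 2 n
        - sin (3 * \<theta> n) * decay 3 n + cos (4 * \<theta> n) * decay 4 n + sin (5 * \<theta> n) * decay 5 n
     - cos (6 * \<theta> n) * decay 6 n - sin (7 * \<theta> n) * decay 7 n + cos (8 * \<theta> n) * decay 8 n + sin (9 * \<theta> n) *
         decay 9 n\<bar> \<le> C * decay 10 n"
      unfolding cos_multiples_shifted decay_def by (simp only: times_divide_eq_right mult_1_right)
  qed
qed

text \<open>
The equation for \<open>\<theta>\<close> first gives \<open>\<theta> = O(2\<^bsup>-(n+1)\<^esup>)\<close>.  Replacing sines and cosines by the Taylor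
terms that matter costs \<open>O(10\<^bsup>-(n+1)\<^esup>)\<close>, and then \<open>\<theta> = 2\<^bsup>-(n+1)\<^esup> + O(4\<^bsup>-(n+1)\<^esup>)\<close> allows one to replace
\<open>\<theta>\<close> by \<open>2\<^bsup>-(n+1)\<^esup>\<close> in the terms \<open>\<theta>\<^sup>3 / 6\<close>, \<open>2 \<theta>\<^sup>2 2\<^bsup>-(n+1)\<^esup>\<close> and \<open>3 \<theta> 3\<^bsup>-(n+1)\<^esup>\<close>.  The coefficients
are \<open>4 = 3 + 1\<close> at \<open>6\<^bsup>-(n+1)\<^esup>\<close> and \<open>-17/6 = 1/6 - 2 - 1\<close> at \<open>8\<^bsup>-(n+1)\<^esup>\<close>.
\<close>

lemma pos_zero_expansion:
  fixes F :: "nat filter"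
  defines "F \<equiv> inf sequentially (principal {n. odd n})"
  shows "(\<lambda>n. pos_zero n - 1 / 2) \<in> O[F](decay 2)"
    and "(\<lambda>n. pi * (pos_zero n - 1 / 2) - (decay 2 n - decay 4 n + 4 * decay 6 n - 17 / 6 * decay 8 n))
        \<in> O[F](decay 10)"
proof -
  define \<theta> where "\<theta> n = pi * (pos_zero n - 1 / 2)" for n
  define R where "R n = sin (\<theta> n) - cos (2 * \<theta> n) * decay 2 n
      - sin (3 * \<theta> n) * decay 3 n + cos (4 * \<theta> n) * decay 4 n + sin (5 * \<theta> n) * decay 5 n
     - cos (6 * \<theta> n) * decay 6 n - sin (7 * \<theta> n) * decay 7 n + cos (8 * \<theta> n) * decay 8 n + sin (9 * \<theta> n) *
         decay 9 n" for n
  obtain C where C: "\<And>n. odd n \<Longrightarrow> \<bar>\<theta> n\<bar> \<le> pi / 2 \<and> \<bar>R n\<bar> \<le> C * decay 10 n"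
    using pos_zero_equation unfolding \<theta>_def R_def by blast
  have F: "eventually odd F" by (auto simp: F_def eventually_inf_principal)
  have R: "R \<in> O[F](decay 10)"
    using C by (intro bigoI[where c = C] eventually_mono[OF F]) (auto simp: decay_def)
  have decay_self: "decay b \<in> O[F](decay c)" if "0 < c" "c \<le> b" for b c
    using that by (intro bigo_decay_mono[of "decay b" F b c]) auto
  have bounded_times: "(\<lambda>n. g n * decay b n) \<in> O[F](decay 2)" if "2 \<le> b" "\<And>n. \<bar>g n\<bar> \<le> 1" for g b
  proof -
    have "g \<in> O[F](\<lambda>_. 1)" using that by (intro bigoI[of _ 1]) auto
    from landau_o.big.mult[OF this decay_self[OF _ that(1)]] show ?thesis by simp
  qed
  have sin_\<theta>: "(\<lambda>n. sin (\<theta> n)) \<in> O[F](decay 2)"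
  proof -
    have "(\<lambda>n. R n + cos (2 * \<theta> n) * decay 2 n + sin (3 * \<theta> n) * decay 3 n - cos (4 * \<theta> n) * decay 4 n
        - sin (5 * \<theta> n) * decay 5 n
     + cos (6 * \<theta> n) * decay 6 n + sin (7 * \<theta> n) * decay 7 n - cos (8 * \<theta> n) * decay 8 n
         - sin (9 * \<theta> n) * decay 9 n) \<in> O[F](decay 2)"
      by (intro sum_in_bigo bounded_times bigo_decay_mono[OF R]) auto
    then show ?thesis by (simp add: R_def)
  qed
  have "\<theta> \<in> O[F](\<lambda>n. sin (\<theta> n))"
    using C abs_le_abs_sin by (intro bigoI[where c = 3] eventually_mono[OF F]) auto
  from landau_o.big.trans[OF this sin_\<theta>] have \<theta>: "\<theta> \<in> O[F](decay 2)" .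
  have "(\<lambda>n. 1 / pi * \<theta> n) \<in> O[F](decay 2)" using \<theta> by simp
  then show "(\<lambda>n. pos_zero n - 1 / 2) \<in> O[F](decay 2)" by (simp add: \<theta>_def)

  \<comment> \<open>The errors of replacing the trigonometric functions by the Taylor terms that contribute; each is
  of order at most \<open>10\<^bsup>-(n+1)\<^esup>\<close>.\<close>
  define T1 where "T1 n = sin (\<theta> n) - \<theta> n + \<theta> n ^ 3 / 6" for n
  define T2 where "T2 n = (cos (2 * \<theta> n) - 1 + 2 * \<theta> n ^ 2) * decay 2 n" for n
  define T3 where "T3 n = (sin (3 * \<theta> n) - 3 * \<theta> n) * decay 3 n" for n
  define T4 where "T4 n = (cos (4 * \<theta> n) - 1) * decay 4 n" for n
  define T5 where "T5 n = sin (5 * \<theta> n) * decay 5 n" for n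
  define T6 where "T6 n = (cos (6 * \<theta> n) - 1) * decay 6 n" for n
  define T7 where "T7 n = sin (7 * \<theta> n) * decay 7 n" for n
  define T8 where "T8 n = (cos (8 * \<theta> n) - 1) * decay 8 n" for n
  define T9 where "T9 n = sin (9 * \<theta> n) * decay 9 n" for n
  have sin_mult: "(\<lambda>n. sin (a * \<theta> n)) \<in> O[F](decay 2)" for a
    by (rule bigo_decay_compose[OF \<theta>, where f = "\<lambda>x. sin (a * x)" and C = "\<bar>a\<bar>" and j = 1])
       (use abs_sin_x_le_abs_x in \<open>auto simp flip: abs_mult\<close>)
  have cos_mult: "(\<lambda>n. cos (a * \<theta> n) - 1) \<in> O[F](decay 4)" for a
    by (rule bigo_decay_compose[OF \<theta>, where f = "\<lambda>x. cos (a * x) - 1" and C = "\<bar>a\<bar> ^ 2" and j = 2])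
       (use abs_cos_minus_one_le in \<open>auto simp flip: abs_mult power_mult_distrib\<close>)
  have T1: "T1 \<in> O[F](decay 10)"
    unfolding T1_def
    by (rule bigo_decay_mono[OF bigo_decay_compose[OF \<theta>, where f = "\<lambda>x. sin x - x + x ^ 3 / 6" and C
        = 1 and j = 5]])
       (use abs_sin_minus_cubic_le in auto)
  have c2: "\<bar>cos (2 * x) - 1 + 2 * x ^ 2\<bar> \<le> 16 * \<bar>x\<bar> ^ 4" for x :: real
    using abs_cos_minus_quadratic_le[of "2 * x"] by (simp add: power_mult_distrib abs_mult)
  have T2: "T2 \<in> O[F](decay 10)"
    unfolding T2_def
    by (rule bigo_decay_mono[OF bigo_decay_mult[OF
        bigo_decay_compose[OF \<theta>, where f = "\<lambda>x. cos (2 * x) - 1 + 2 * x ^ 2" and C = 16 and j = 4]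
            decay_self[of 2]]])
       (use c2 in auto)
  have s3: "\<bar>sin (3 * x) - 3 * x\<bar> \<le> 27 * \<bar>x\<bar> ^ 3" for x :: real
  proof -
    have "\<bar>sin (3 * x) - 3 * x\<bar> \<le> \<bar>3 * x\<bar> ^ 3 / 6" by (rule abs_sin_minus_self_le)
    also have "\<dots> \<le> \<bar>3 * x\<bar> ^ 3" by (simp add: divide_le_eq)
    also have "\<dots> = 27 * \<bar>x\<bar> ^ 3" by (simp add: abs_mult power_mult_distrib)
    finally show ?thesis .
  qed
  have T3: "T3 \<in> O[F](decay 10)"
    unfolding T3_def
    by (rule bigo_decay_mono[OF bigo_decay_mult[OF
        bigo_decay_compose[OF \<theta>, where f = "\<lambda>x. sin (3 * x) - 3 * x" and C = 27 and j = 3] decay_self[of 3]]])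
       (use s3 in auto)
  have T4: "T4 \<in> O[F](decay 10)" unfolding T4_def
    by (rule bigo_decay_mono[OF bigo_decay_mult[OF cos_mult decay_self[of 4]]]) auto
  have T5: "T5 \<in> O[F](decay 10)" unfolding T5_def
    by (rule bigo_decay_mono[OF bigo_decay_mult[OF sin_mult decay_self[of 5]]]) auto
  have T6: "T6 \<in> O[F](decay 10)" unfolding T6_def
    by (rule bigo_decay_mono[OF bigo_decay_mult[OF cos_mult decay_self[of 6]]]) auto
  have T7: "T7 \<in> O[F](decay 10)" unfolding T7_def
    by (rule bigo_decay_mono[OF bigo_decay_mult[OF sin_mult decay_self[of 7]]]) auto
  have T8: "T8 \<in> O[F](decay 10)" unfolding T8_def
    by (rule bigo_decay_mono[OF bigo_decay_mult[OF cos_mult decay_self[of 8]]]) auto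
  have T9: "T9 \<in> O[F](decay 10)" unfolding T9_def
    by (rule bigo_decay_mono[OF bigo_decay_mult[OF sin_mult decay_self[of 9]]]) auto
  define V where "V n = R n - T1 n + T2 n + T3 n - T4 n - T5 n + T6 n + T7 n - T8 n - T9 n" for n
  have V: "V \<in> O[F](decay 10)"
    unfolding V_def by (intro sum_in_bigo R T1 T2 T3 T4 T5 T6 T7 T8 T9)
  have V_eq: "V n = \<theta> n - \<theta> n ^ 3 / 6 - (1 - 2 * \<theta> n ^ 2) * decay 2 n - 3 * \<theta> n * decay 3 n + decay 4 n
      - decay 6 n + decay 8 n" for n
    unfolding V_def R_def T1_def T2_def T3_def T4_def T5_def T6_def T7_def T8_def T9_def
        by (simp add: algebra_simps)

  \<comment> \<open>First approximation \<open>\<theta> = 2\<^bsup>-(n+1)\<^esup> + O(4\<^bsup>-(n+1)\<^esup>)\<close>.\<close>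
  define d where "d n = \<theta> n - decay 2 n" for n
  have \<theta>2: "(\<lambda>n. \<theta> n * \<theta> n) \<in> O[F](decay 4)" using bigo_decay_mult[OF \<theta> \<theta>] by simp
  have "(\<lambda>n. V n + (\<theta> n * \<theta> n) * \<theta> n * (1 / 6) - 2 * ((\<theta> n * \<theta> n) * decay 2 n) + 3 * (\<theta> n * decay 3 n)
      - decay 4 n + decay 6 n - decay 8 n) \<in> O[F](decay 4)"
  proof (intro sum_in_bigo)
    show "V \<in> O[F](decay 4)" by (rule bigo_decay_mono[OF V]) auto
    have "(\<lambda>n. (\<theta> n * \<theta> n) * \<theta> n) \<in> O[F](decay 4)" by (rule bigo_decay_mono[OF bigo_decay_mult[OF \<theta>2 \<theta>]]) auto
    then show "(\<lambda>n. (\<theta> n * \<theta> n) * \<theta> n * (1 / 6)) \<in> O[F](decay 4)" by simp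
    have "(\<lambda>n. (\<theta> n * \<theta> n) * decay 2 n) \<in> O[F](decay 4)"
        by (rule bigo_decay_mono[OF bigo_decay_mult[OF \<theta>2 decay_self[of 2]]]) auto
    then show "(\<lambda>n. 2 * ((\<theta> n * \<theta> n) * decay 2 n)) \<in> O[F](decay 4)" by simp
    have "(\<lambda>n. \<theta> n * decay 3 n) \<in> O[F](decay 4)"
        by (rule bigo_decay_mono[OF bigo_decay_mult[OF \<theta> decay_self[of 3]]]) auto
    then show "(\<lambda>n. 3 * (\<theta> n * decay 3 n)) \<in> O[F](decay 4)" by simp
  qed (auto intro: decay_self)
  moreover have "V n + (\<theta> n * \<theta> n) * \<theta> n * (1 / 6) - 2 * ((\<theta> n * \<theta> n) * decay 2 n) + 3 * (\<theta> n * decay 3 n)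
      - decay 4 n + decay 6 n - decay 8 n = d n" for n
    unfolding V_eq d_def by (simp add: algebra_simps power2_eq_square power3_eq_cube)
  ultimately have d: "d \<in> O[F](decay 4)" by simp
  have decay4: "decay 4 n = decay 2 n * decay 2 n" "decay 8 n = decay 2 n * (decay 2 n * decay 2 n)"
      "decay 6 n = decay 2 n * decay 3 n" for n
    by (simp_all add: decay_mult)

  \<comment> \<open>The factor \<open>d\<close> comes from \<open>\<theta>\<^sup>3 - \<epsilon>\<^sup>3\<close>, \<open>\<theta>\<^sup>2 - \<epsilon>\<^sup>2\<close> and \<open>\<theta> - \<epsilon>\<close>, where \<open>\<epsilon> = 2\<^bsup>-(n+1)\<^esup>\<close>.\<close>
  have c1: "(\<lambda>n. d n * (\<theta> n * \<theta> n + \<theta> n * decay 2 n + decay 4 n)) \<in> O[F](decay 10)"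
  proof (rule bigo_decay_mono[OF bigo_decay_mult[OF d]])
    show "(\<lambda>n. \<theta> n * \<theta> n + \<theta> n * decay 2 n + decay 4 n) \<in> O[F](decay 4)"
      using bigo_decay_mult[OF \<theta> decay_self[of 2 2]] by (intro sum_in_bigo \<theta>2 decay_self) auto
  qed auto
  have c2: "(\<lambda>n. d n * ((\<theta> n + decay 2 n) * decay 2 n)) \<in> O[F](decay 10)"
  proof (rule bigo_decay_mono[OF bigo_decay_mult[OF d bigo_decay_mult]])
    show "(\<lambda>n. \<theta> n + decay 2 n) \<in> O[F](decay 2)" by (intro sum_in_bigo \<theta> decay_self) auto
    show "decay 2 \<in> O[F](decay 2)" by (intro decay_self) auto
  qed auto
  have c3: "(\<lambda>n. d n * decay 3 n) \<in> O[F](decay 10)"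
    by (rule bigo_decay_mono[OF bigo_decay_mult[OF d decay_self[of 3]]]) auto
  have "(\<lambda>n. V n + 1 / 6 * (d n * (\<theta> n * \<theta> n + \<theta> n * decay 2 n + decay 4 n))
      - 2 * (d n * ((\<theta> n + decay 2 n) * decay 2 n)) + 3 * (d n * decay 3 n)) \<in> O[F](decay 10)"
    using c1 c2 c3 by (intro sum_in_bigo V) simp_all
  moreover have "V n + 1 / 6 * (d n * (\<theta> n * \<theta> n + \<theta> n * decay 2 n + decay 4 n))
      - 2 * (d n * ((\<theta> n + decay 2 n) * decay 2 n)) + 3 * (d n * decay 3 n)
      = \<theta> n - (decay 2 n - decay 4 n + 4 * decay 6 n - 17 / 6 * decay 8 n)" for n
    unfolding V_eq d_def decay4 by (simp add: algebra_simps power2_eq_square power3_eq_cube)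
  ultimately show "(\<lambda>n. pi * (pos_zero n - 1 / 2)
      - (decay 2 n - decay 4 n + 4 * decay 6 n - 17 / 6 * decay 8 n)) \<in> O[F](decay 10)"
    by (simp add: \<theta>_def)
qed

lemma pos_zero_asymptotics:
  fixes F :: "nat filter"
  defines "F \<equiv> inf sequentially (principal {n. odd n})"
  shows "(pos_zero \<longlongrightarrow> 1 / 2) F"
    and "(\<lambda>n. pos_zero n - 1 / 2 -
        (1 / (pi * 2 ^ (n + 1)) - 1 / (pi * 4 ^ (n + 1)) + 4 / (pi * 6 ^ (n + 1))
          - 17 / (6 * pi * 8 ^ (n + 1)))) \<in> O[F](\<lambda>n. 1 / 10 ^ (n + 1))"
proof -
  have "(decay 2 \<longlongrightarrow> 0) F"
  proof (rule tendsto_mono)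
    show "decay 2 \<longlonglongrightarrow> 0"
      unfolding decay_def using LIMSEQ_Suc[OF LIMSEQ_realpow_zero[of "1 / 2 :: real"]]
          by (simp add: power_divide)
  qed (simp add: F_def)
  then have "((\<lambda>n. pos_zero n - 1 / 2) \<longlongrightarrow> 0) F"
  proof -
    obtain C where "\<forall>\<^sub>F n in F. norm (pos_zero n - 1 / 2) \<le> C * norm (decay 2 n)"
      using landau_o.bigE[OF pos_zero_expansion(1)[folded F_def]] by blast
    moreover assume "(decay 2 \<longlongrightarrow> 0) F"
    then have "((\<lambda>n. C * norm (decay 2 n)) \<longlongrightarrow> 0) F" by (intro tendsto_mult_right_zero tendsto_norm_zero)
    ultimately show ?thesis by (rule Lim_null_comparison)
  qed
  then show "(pos_zero \<longlongrightarrow> 1 / 2) F"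
    by (simp add: LIM_zero_iff)
  have "(\<lambda>n. 1 / pi * (pi * (pos_zero n - 1 / 2)
      - (decay 2 n - decay 4 n + 4 * decay 6 n - 17 / 6 * decay 8 n))) \<in> O[F](decay 10)"
    using pos_zero_expansion(2)[folded F_def] by simp
  moreover have "1 / pi * (pi * (pos_zero n - 1 / 2)
      - (decay 2 n - decay 4 n + 4 * decay 6 n - 17 / 6 * decay 8 n)) =
      pos_zero n - 1 / 2 - (1 / (pi * 2 ^ (n + 1)) - 1 / (pi * 4 ^ (n + 1)) + 4 / (pi * 6 ^ (n + 1))
          - 17 / (6 * pi * 8 ^ (n + 1)))" for n
    by (simp add: decay_def diff_divide_distrib add_divide_distrib right_diff_distrib distrib_left)
  moreover have "decay 10 = (\<lambda>n. 1 / 10 ^ (n + 1))" by (simp add: decay_def fun_eq_iff)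
  ultimately show "(\<lambda>n. pos_zero n - 1 / 2 -
        (1 / (pi * 2 ^ (n + 1)) - 1 / (pi * 4 ^ (n + 1)) + 4 / (pi * 6 ^ (n + 1))
          - 17 / (6 * pi * 8 ^ (n + 1)))) \<in> O[F](\<lambda>n. 1 / 10 ^ (n + 1))"
    by (simp only:)
qed

section \<open>The central difference operator\<close>

text \<open>
The polynomial \<open>p(s + 1) - p(s - 1)\<close>.  If \<open>p\<close> is written in the local coordinate of an element of
length \<open>h\<close> and \<open>s\<close> is the coordinate \<open>2 (x - \<xi>) / h\<close> centred at a node \<open>\<xi>\<close>, this compares \<open>p\<close> on the
elements to the left and to the right of \<open>\<xi>\<close>.
\<close>

definition shift_diff :: "real poly \<Rightarrow> real poly" where
  "shift_diff p = p \<circ>\<^sub>p [:1, 1:] - p \<circ>\<^sub>p [:-1, 1:]"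

lemma shift_diff_add: "shift_diff (p + q) = shift_diff p + shift_diff q"
  by (simp add: shift_diff_def pcompose_add)

lemma shift_diff_smult: "shift_diff (smult c p) = smult c (shift_diff p)"
  by (simp add: shift_diff_def pcompose_smult smult_diff_right)

lemma shift_diff_const: "shift_diff [:c:] = 0"
  by (simp add: shift_diff_def)

lemma shift_diff_sum: "shift_diff (\<Sum>j\<in>A. f j) = (\<Sum>j\<in>A. shift_diff (f j))"
  by (simp add: shift_diff_def pcompose_sum sum_subtractf)

lemma pderiv_shift_diff: "pderiv (shift_diff p) = shift_diff (pderiv p)"
  by (simp add: shift_diff_def pderiv_diff pderiv_pcompose pderiv_pCons)

text \<open>
The difference equation of the Bernoulli polynomials.  Differentiating reduces \<open>n + 1\<close> to \<open>n\<close>;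
the constant of integration vanishes by the equal endpoint values.
\<close>

lemma shift_diff_Fpoly: "shift_diff (Fpoly n) = monom (2 / fact n) n"
proof (induction n)
  case 0
  then show ?case by (simp add: shift_diff_def Fpoly_0 pcompose_pCons monom_0)
next
  case (Suc n)
  define D where "D = shift_diff (Fpoly (Suc n)) - monom (2 / fact (Suc n)) (Suc n)"
  have "real (Suc n) * (2 / fact (Suc n)) = 2 / fact n"
    by (subst fact_Suc) (simp del: of_nat_Suc)
  then have "pderiv D = 0"
    using Suc by (simp only: D_def pderiv_diff pderiv_shift_diff pderiv_Fpoly pderiv_monom) simp
  then obtain c where c: "D = [:c:]" by (metis degree_0_id pderiv_eq_0_iff)
  have "poly D 0 = 0"
    by (simp add: D_def shift_diff_def poly_pcompose poly_monom Fpoly_endpoints)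
  then have "D = 0" using c by simp
  then show ?case by (simp add: D_def)
qed

text \<open>
By induction through the derivative, which commutes with the difference.
\<close>

lemma degree_coeff_shift_diff:
  "degree p \<le> Suc j \<Longrightarrow> degree (shift_diff p) \<le> j \<and> coeff (shift_diff p) j = 2 * real (Suc j) * coeff p (Suc j)"
proof (induction j arbitrary: p)
  case 0
  have "p = [:coeff p 0, coeff p 1:]"
  proof (rule poly_eqI)
    fix i show "coeff p i = coeff [:coeff p 0, coeff p 1:] i"
      using 0 by (cases "i \<le> 1") (auto simp: coeff_eq_0 le_Suc_eq coeff_pCons split: nat.splits)
  qed
  then obtain c d where "p = [:c, d:]" by blast
  then show ?case by (simp add: shift_diff_def pcompose_pCons)
next
  case (Suc j)
  have "degree (pderiv p) \<le> Suc j" using Suc.prems by (simp add: degree_pderiv)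
  note IH = Suc.IH[OF this]
  have "degree (shift_diff p) \<le> Suc j"
    using IH degree_pderiv[of "shift_diff p"] unfolding pderiv_shift_diff by linarith
  moreover have "real (Suc j) * coeff (shift_diff p) (Suc j)
      = real (Suc j) * (2 * real (Suc (Suc j)) * coeff p (Suc (Suc j)))"
    using IH coeff_pderiv[of "shift_diff p" j] coeff_pderiv[of p "Suc j"]
    by (simp add: pderiv_shift_diff del: of_nat_Suc)
  then have "coeff (shift_diff p) (Suc j) = 2 * real (Suc (Suc j)) * coeff p (Suc (Suc j))"
    by (subst (asm) mult_left_cancel) auto
  ultimately show ?case by simp
qed

section \<open>Splines and Taylor polynomials on two adjacent elements\<close>

text \<open>
Derivatives within a nondegenerate closed interval are unique, so the derivatives \<open>D j\<close> of a smooth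
function that is a polynomial on an interval agree with those of the polynomial up to the
ends of that interval.
\<close>

lemma smooth_eq_poly_derivatives:
  assumes D: "\<And>j y. j < m \<Longrightarrow> y \<in> S \<Longrightarrow> (D j has_real_derivative D (Suc j) y) (at y within S)"
    and S: "{l..r} \<subseteq> S" "l < r" and p: "\<And>y. y \<in> {l..r} \<Longrightarrow> D 0 y = poly p y"
  shows "j \<le> m \<Longrightarrow> y \<in> {l..r} \<Longrightarrow> D j y = poly ((pderiv ^^ j) p) y"
proof (induction j arbitrary: y)
  case (Suc j)
  have "(D j has_real_derivative D (Suc j) y) (at y within {l..r})"
    using Suc.prems S by (intro DERIV_subset[OF D S(1)]) auto
  then have "(poly ((pderiv ^^ j) p) has_real_derivative D (Suc j) y) (at y within {l..r})"
    by (rule has_field_derivative_transform_within[where d = 1]) (use Suc in auto)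
  moreover have "(poly ((pderiv ^^ j) p) has_real_derivative poly ((pderiv ^^ Suc j) p) y) (at y within {l..r})"
    using poly_DERIV[of "(pderiv ^^ j) p" y] by (auto intro: has_field_derivative_at_within)
  ultimately show ?case
    using vector_derivative_unique_within_closed_interval[of l r y] S(2) Suc.prems(2)
    by (simp add: has_real_derivative_iff_has_vector_derivative)
qed (use p in simp)

text \<open>
At an interior node both pieces take over the derivatives \<open>D j\<close> of the spline itself.
\<close>

lemma spline_pieces:
  assumes v: "v \<in> spline_space k \<mu> N x" and mesh: "is_mesh a b N x" and i: "1 < i" "i \<le> N"
    and nodes: "x 1 < x i" "x i < x (N + 1)"
  obtains p q where "degree p \<le> k" "degree q \<le> k" "\<And>y. y \<in> {x (i - 1)..x i} \<Longrightarrow> v y = poly p y"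
    "\<And>y. y \<in> {x i..x (i + 1)} \<Longrightarrow> v y = poly q y"
    "\<And>j. j \<le> \<mu> \<Longrightarrow> poly ((pderiv ^^ j) p) (x i) = poly ((pderiv ^^ j) q) (x i)"
proof -
  have "i - 1 \<in> {1..N}" "i \<in> {1..N}" "i - 1 + 1 = i" using i by auto
  moreover have "\<forall>i\<in>{1..N}. \<exists>p :: real poly. degree p \<le> k \<and> (\<forall>y\<in>{x i..x (i + 1)}. v y = poly p y)"
    using v unfolding spline_space_def by blast
  ultimately have "\<exists>p :: real poly. degree p \<le> k \<and> (\<forall>y\<in>{x (i - 1)..x i}. v y = poly p y)"
    "\<exists>q :: real poly. degree q \<le> k \<and> (\<forall>y\<in>{x i..x (i + 1)}. v y = poly q y)" by fastforce+
  then obtain p q :: "real poly" where p: "degree p \<le> k" "\<And>y. y \<in> {x (i - 1)..x i} \<Longrightarrow> v y = poly p y"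
    and q: "degree q \<le> k" "\<And>y. y \<in> {x i..x (i + 1)} \<Longrightarrow> v y = poly q y" by blast
  have lt: "x (i - 1) < x i" "x i < x (i + 1)"
    using mesh \<open>i - 1 \<in> {1..N}\<close> \<open>i \<in> {1..N}\<close> \<open>i - 1 + 1 = i\<close> unfolding is_mesh_def by metis+
  define S where "S = {x 1<..<x (N + 1)}"
  obtain D :: "nat \<Rightarrow> real \<Rightarrow> real" where D0: "\<And>y. y \<in> S \<Longrightarrow> D 0 y = v y"
    and D: "\<And>j y. j < \<mu> \<Longrightarrow> y \<in> S \<Longrightarrow> (D j has_real_derivative D (Suc j) y) (at y within S)"
    using v unfolding spline_space_def C_on_def S_def by blast
  \<comment> \<open>Shrunk so that the closed intervals stay inside the open domain on which the spline is
  smooth, even next to a boundary element.\<close>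
  define l r where "l = max (x (i - 1)) ((x 1 + x i) / 2)" and "r = min (x (i + 1)) ((x i + x (N + 1)) / 2)"
  have lr: "l < x i" "x i < r" "{l..x i} \<subseteq> S" "{x i..r} \<subseteq> S" "{l..x i} \<subseteq> {x (i - 1)..x i}"
      "{x i..r} \<subseteq> {x i..x (i + 1)}"
    using lt nodes by (auto simp: l_def r_def S_def)
  have "D j (x i) = poly ((pderiv ^^ j) p) (x i)" "D j (x i) = poly ((pderiv ^^ j) q) (x i)" if "j \<le> \<mu>" for j
  proof -
    show "D j (x i) = poly ((pderiv ^^ j) p) (x i)"
      by (rule smooth_eq_poly_derivatives[where S = S and m = \<mu> and D = D, OF _ lr(3,1)])
          (use that lr p D0 D in auto)
    show "D j (x i) = poly ((pderiv ^^ j) q) (x i)"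
      by (rule smooth_eq_poly_derivatives[where S = S and m = \<mu> and D = D, OF _ lr(4,2)])
          (use that lr q D0 D in auto)
  qed
  then show thesis using that p q by metis
qed

lemma coeff_pcompose_eq_0:
  fixes r :: "real poly"
  shows "(\<And>j. j \<le> i \<Longrightarrow> poly ((pderiv ^^ j) r) \<xi> = 0) \<Longrightarrow> coeff (r \<circ>\<^sub>p [:\<xi>, c:]) i = 0"
proof (induction i arbitrary: r)
  case 0
  then show ?case using 0[of 0] by (simp add: poly_pcompose flip: poly_0_coeff_0)
next
  case (Suc i)
  have "coeff (pderiv r \<circ>\<^sub>p [:\<xi>, c:]) i = 0"
    using Suc.prems[of "Suc _"] by (intro Suc.IH) (simp add: funpow_swap1)
  then have "coeff (pderiv (r \<circ>\<^sub>p [:\<xi>, c:])) i = 0"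
    by (simp add: pderiv_pcompose pderiv_pCons)
  then show ?case by (simp add: coeff_pderiv)
qed

text \<open>
Taylor's theorem with a constant that is uniform in the base point.
\<close>

lemma C_on_Taylor:
  assumes "C_on (Suc m) u {a..b}"
  obtains T C where "\<And>\<xi>. degree (T \<xi> :: real poly) \<le> m"
    "\<And>\<xi> y. \<xi> \<in> {a<..<b} \<Longrightarrow> y \<in> {a<..<b} \<Longrightarrow> \<bar>u y - poly (T \<xi>) (y - \<xi>)\<bar> \<le> C * \<bar>y - \<xi>\<bar> ^ Suc m"
proof -
  obtain D :: "nat \<Rightarrow> real \<Rightarrow> real" where D0: "\<And>y. y \<in> {a..b} \<Longrightarrow> D 0 y = u y"
    and D: "\<And>j y. j < Suc m \<Longrightarrow> y \<in> {a..b} \<Longrightarrow> (D j has_real_derivative D (Suc j) y) (at y within {a..b})"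
    and cont: "continuous_on {a..b} (D (Suc m))"
    using assms unfolding C_on_def by blast
  obtain C where "\<forall>z\<in>D (Suc m) ` {a..b}. \<bar>z\<bar> \<le> C"
    using compact_imp_bounded[OF compact_continuous_image[OF cont compact_Icc]]
    unfolding bounded_real by blast
  then have C: "\<And>y. y \<in> {a..b} \<Longrightarrow> \<bar>D (Suc m) y\<bar> \<le> C" by blast
  define T where "T \<xi> = (\<Sum>j\<le>m. monom (D j \<xi> / fact j) j)" for \<xi>
  show thesis
  proof
    show "degree (T \<xi>) \<le> m" for \<xi>
      unfolding T_def by (intro degree_sum_le) (auto intro: order.trans[OF degree_monom_le])
    fix \<xi> y assume \<xi>: "\<xi> \<in> {a<..<b}" and y: "y \<in> {a<..<b}"
    have T: "poly (T \<xi>) (y - \<xi>) = (\<Sum>j<Suc m. D j \<xi> / fact j * (y - \<xi>) ^ j)"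
      by (simp add: T_def poly_sum poly_monom lessThan_Suc_atMost del: sum.lessThan_Suc)
    show "\<bar>u y - poly (T \<xi>) (y - \<xi>)\<bar> \<le> C * \<bar>y - \<xi>\<bar> ^ Suc m"
    proof (cases "y = \<xi>")
      case True
      have "(\<Sum>j<Suc m. D j \<xi> / fact j * (y - \<xi>) ^ j) = D 0 \<xi>"
        using True by (subst sum.lessThan_Suc_shift) simp
      then show ?thesis using True T D0[of y] y by simp
    next
      case False
      have "\<exists>t. (if y < \<xi> then y < t \<and> t < \<xi> else \<xi> < t \<and> t < y) \<and>
        D 0 y = (\<Sum>j<Suc m. D j \<xi> / fact j * (y - \<xi>) ^ j) + D (Suc m) t / fact (Suc m) * (y - \<xi>) ^ Suc m"
      proof (rule Taylor[where a = "min y \<xi>" and b = "max y \<xi>"])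
        show "\<forall>j t. j < Suc m \<and> min y \<xi> \<le> t \<and> t \<le> max y \<xi> \<longrightarrow> (D j has_real_derivative D (Suc j) t) (at t)"
        proof (intro allI impI)
          fix j t assume t: "j < Suc m \<and> min y \<xi> \<le> t \<and> t \<le> max y \<xi>"
          then have "t \<in> {a<..<b}" using \<xi> y by (auto simp: min_def max_def split: if_splits)
          then have "t \<in> interior {a..b}" "t \<in> {a..b}" by auto
          then show "(D j has_real_derivative D (Suc j) t) (at t)"
            using D[of j t] t at_within_interior[of t "{a..b}"] by simp
        qed
      qed (use False in auto)
      then obtain t where t: "if y < \<xi> then y < t \<and> t < \<xi> else \<xi> < t \<and> t < y"
        "D 0 y = (\<Sum>j<Suc m. D j \<xi> / fact j * (y - \<xi>) ^ j) + D (Suc m) t / fact (Suc m) * (y - \<xi>) ^ Suc m"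
        by blast
      have "u y - poly (T \<xi>) (y - \<xi>) = D (Suc m) t / fact (Suc m) * (y - \<xi>) ^ Suc m"
        using t(2) T D0[of y] y by simp
      moreover have "\<bar>D (Suc m) t / fact (Suc m)\<bar> \<le> C"
      proof -
        have "t \<in> {a..b}" using t(1) \<xi> y by (auto split: if_splits)
        then have "\<bar>D (Suc m) t\<bar> \<le> C" by (rule C)
        moreover have "\<bar>D (Suc m) t\<bar> / fact (Suc m) \<le> \<bar>D (Suc m) t\<bar> / 1"
          by (intro divide_left_mono) (auto simp: fact_ge_1 simp del: fact_Suc)
        ultimately show ?thesis by (simp del: fact_Suc)
      qed
      ultimately show ?thesis by (simp only: abs_mult power_abs mult_right_mono zero_le_power abs_ge_zero)
    qed
  qed
qed

text \<open>
Finitely many values control the coefficients of a polynomial of bounded degree, so a bound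
at each point suffices, without any uniformity.  The induction divides by a linear factor; the
quotient is controlled at all points of \<open>S\<close> but one.
\<close>

lemma coeff_bigo_of_pointwise:
  fixes p :: "'a \<Rightarrow> real poly" and g :: "'a \<Rightarrow> real"
  assumes "\<And>n. degree (p n) \<le> D" "infinite S" "\<And>t. t \<in> S \<Longrightarrow> (\<lambda>n. poly (p n) t) \<in> O[F](g)"
  shows "(\<lambda>n. coeff (p n) i) \<in> O[F](g)"
  using assms
proof (induction D arbitrary: p S i)
  case 0
  then have p: "p n = [:coeff (p n) 0:]" for n by (metis degree_0_id le_zero_eq)
  obtain t where t: "t \<in> S" using 0(2) by fastforce
  have "(\<lambda>n. coeff (p n) 0) = (\<lambda>n. poly (p n) t)" by (subst (2) p) simp
  with 0(3)[OF t] have "(\<lambda>n. coeff (p n) 0) \<in> O[F](g)" by simp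
  moreover have "coeff (p n) i = 0" if "i \<noteq> 0" for n using 0(1)[of n] that by (intro coeff_eq_0) auto
  ultimately show ?case by (cases "i = 0") auto
next
  case (Suc D)
  obtain t0 where t0: "t0 \<in> S" using Suc.prems(2) by fastforce
  define q where "q n = synthetic_div (p n) t0" for n
  have p: "p n = [:- t0, 1:] * q n + [:poly (p n) t0:]" for n
    unfolding q_def by (rule synthetic_div_correct'[symmetric])
  have q: "(\<lambda>n. coeff (q n) j) \<in> O[F](g)" for j
  proof (rule Suc.IH)
    show "degree (q n) \<le> D" for n using Suc.prems(1)[of n] by (simp add: q_def degree_synthetic_div)
    show "infinite (S - {t0})" using Suc.prems(2) by simp
    fix t assume t: "t \<in> S - {t0}"
    have "poly (q n) t = 1 / (t - t0) * (poly (p n) t - poly (p n) t0)" for n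
      using t arg_cong[OF p[of n], of "\<lambda>r. poly r t"] by (simp add: field_simps)
    moreover have "(\<lambda>n. 1 / (t - t0) * (poly (p n) t - poly (p n) t0)) \<in> O[F](g)"
      using sum_in_bigo(2)[OF Suc.prems(3)[of t] Suc.prems(3)[OF t0]] t
      by (subst landau_o.big.cmult_in_iff) auto
    ultimately show "(\<lambda>n. poly (q n) t) \<in> O[F](g)" by simp
  qed
  show ?case
  proof (cases i)
    case 0
    have "coeff (p n) 0 = - t0 * coeff (q n) 0 + poly (p n) t0" for n
      using arg_cong[OF p[of n], of "\<lambda>r. coeff r 0"] by simp
    moreover have "(\<lambda>n. - t0 * coeff (q n) 0 + poly (p n) t0) \<in> O[F](g)"
      using q[of 0] Suc.prems(3)[OF t0] by (intro sum_in_bigo(1)) simp_all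
    ultimately show ?thesis using 0 by simp
  next
    case (Suc j)
    have "coeff (p n) (Suc j) = coeff (q n) j - t0 * coeff (q n) (Suc j)" for n
      using arg_cong[OF p[of n], of "\<lambda>r. coeff r (Suc j)"] by simp
    moreover have "(\<lambda>n. coeff (q n) j - t0 * coeff (q n) (Suc j)) \<in> O[F](g)"
      using q by (intro sum_in_bigo(2)) simp_all
    ultimately show ?thesis using Suc by simp
  qed
qed

text \<open>
Back substitution: the polynomials \<open>p j\<close> have exact degree \<open>j\<close>, so the top coefficient of the sum
determines the last weight.
\<close>

lemma triangular_bigo:
  fixes p :: "nat \<Rightarrow> real poly" and w :: "'a \<Rightarrow> nat \<Rightarrow> real" and g :: "'a \<Rightarrow> real"
  assumes "\<And>j. degree (p j) \<le> j" "\<And>j. coeff (p j) j \<noteq> 0"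
    and "\<And>i. i < k \<Longrightarrow> (\<lambda>n. coeff (\<Sum>j<k. smult (w n j) (p j)) i) \<in> O[F](g)" and "j < k"
  shows "(\<lambda>n. w n j) \<in> O[F](g)"
  using assms(3,4)
proof (induction k)
  case (Suc k)
  have "coeff (\<Sum>j<Suc k. smult (w n j) (p j)) k = w n k * coeff (p k) k" for n
  proof -
    have "coeff (p j) k = 0" if "j < k" for j using assms(1)[of j] that by (intro coeff_eq_0) auto
    then show ?thesis by (simp add: coeff_sum)
  qed
  then have "(\<lambda>n. w n k * coeff (p k) k) \<in> O[F](g)" using Suc.prems(1)[of k] by simp
  then have top: "(\<lambda>n. w n k) \<in> O[F](g)" using assms(2)[of k] by simp
  show ?case
  proof (cases "j = k")
    case False
    show ?thesis
    proof (rule Suc.IH)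
      fix i assume "i < k"
      have "(\<lambda>n. w n k * coeff (p k) i) \<in> O[F](g)" using top by (cases "coeff (p k) i = 0") auto
      with sum_in_bigo(2)[OF Suc.prems(1)[of i] this] \<open>i < k\<close>
      show "(\<lambda>n. coeff (\<Sum>j<k. smult (w n j) (p j)) i) \<in> O[F](g)" by (simp add: coeff_sum)
    qed (use False Suc.prems(2) in auto)
  qed (use top in simp)
qed simp


lemma uniform_nodes:
  assumes "\<forall>i\<in>{l..<r}. x (i + 1) - x i = (h :: real)" "l \<le> i" "i \<le> r"
  shows "x i = x l + real (i - l) * h"
  using assms(2,3)
proof (induction i rule: dec_induct)
  case (step n)
  then have e: "x (Suc n) = x n + h" using assms(1) by force
  show ?case unfolding e using step by (simp add: Suc_diff_le algebra_simps)
qed simp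

lemma mesh_size_pos:
  assumes "is_mesh a b N x"
  shows "0 < mesh_size N x"
proof -
  have "N \<in> {1..N}" "x N < x (N + 1)" using assms by (auto simp: is_mesh_def)
  moreover from this have "x (N + 1) - x N \<le> mesh_size N x"
    unfolding mesh_size_def by (intro Max_ge) auto
  ultimately show ?thesis by linarith
qed

text \<open>
Half of the uniform zone is \<open>C h \<bar>ln h\<bar> \<ge> 3 h\<close> wide, so the zone has at least six elements.  Then
its middle node, rounded down, has a neighbour on either side inside the zone.
\<close>

lemma uniform_near_node:
  assumes unif: "uniform_near C x0 N x" and mesh: "is_mesh a b N x"
    and big: "3 \<le> C * \<bar>ln (mesh_size N x)\<bar>"
  obtains i where "1 < i" "i \<le> N" "x i - x (i - 1) = mesh_size N x" "x (i + 1) - x i = mesh_size N x"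
    "\<bar>x i - x0\<bar> \<le> mesh_size N x"
proof -
  define h where "h = mesh_size N x"
  have h: "0 < h" using mesh_size_pos[OF mesh] by (simp add: h_def)
  obtain l r where lr: "1 \<le> l" "l < r" "r \<le> N + 1" "(x l + x r) / 2 = x0"
    "C * h * \<bar>ln h\<bar> \<le> (x r - x l) / 2" and eq: "\<forall>i\<in>{l..<r}. x (i + 1) - x i = h"
    using unif unfolding uniform_near_def h_def by blast
  have xr: "x r = x l + real (r - l) * h" using uniform_nodes[OF eq, of r] lr by simp
  have "3 * h \<le> (C * \<bar>ln h\<bar>) * h" using big h by (intro mult_right_mono) (auto simp: h_def)
  also have "\<dots> \<le> real (r - l) * h / 2" using lr(5) xr by (simp add: mult_ac)
  finally have "6 * h \<le> real (r - l) * h" by simp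
  then have rl: "6 \<le> r - l" using h by simp
  define i where "i = (l + r) div 2"
  have i: "l < i" "i < r" using rl by (auto simp: i_def)
  have "x i = x l + real (i - l) * h" using uniform_nodes[OF eq, of i] i by simp
  moreover have "x0 = x l + real (r - l) * h / 2" using lr(4) xr by simp
  ultimately have "x i - x0 = (real (i - l) - real (r - l) / 2) * h" by (simp add: algebra_simps)
  moreover have "\<bar>real (i - l) - real (r - l) / 2\<bar> \<le> 1"
  proof -
    have "2 * (i - l) \<le> r - l" "r - l \<le> 2 * (i - l) + 1" using i by (auto simp: i_def)
    then have "2 * real (i - l) \<le> real (r - l)" "real (r - l) \<le> 2 * real (i - l) + 1" by linarith+
    then show ?thesis by linarith
  qed
  ultimately have "\<bar>x i - x0\<bar> \<le> h" using h by (simp add: abs_mult)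
  moreover have "x i - x (i - 1) = h" "x (i + 1) - x i = h"
  proof -
    have "i - 1 \<in> {l..<r}" "i \<in> {l..<r}" "i - 1 + 1 = i" using i by auto
    then show "x i - x (i - 1) = h" "x (i + 1) - x i = h" using eq by metis+
  qed
  moreover have "1 < i" "i \<le> N" using i lr by auto
  ultimately show thesis using that by (simp add: h_def)
qed

text \<open>
Let \<open>\<xi>\<close> be a node between two equal elements near \<open>x\<^sub>0\<close> and \<open>s = 2 (y - \<xi>) / h\<close>.  With \<open>A\<close> the
Taylor polynomial of \<open>u\<close> at \<open>\<xi>\<close> and \<open>p\<close>, \<open>q\<close> the pieces of \<open>u\<^sub>h\<close> to the left and right of \<open>\<xi>\<close>, all
in the variable \<open>s\<close>, the error expansion says \<open>A - p = Q(s + 1) + O(h\<^bsup>k+2\<^esup>)\<close> for \<open>s \<in> [-2, 0]\<close> and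
\<open>A - q = Q(s - 1) + O(h\<^bsup>k+2\<^esup>)\<close> for \<open>s \<in> [0, 2]\<close>.  Bounds on an interval bound coefficients, and the
coefficients of \<open>p\<close> and \<open>q\<close> below order \<open>k\<close> coincide by smoothness; so the difference
\<open>Q(s + 1) - Q(s - 1)\<close> has small coefficients there.
\<close>

lemma shift_diff_error_poly:
  fixes k :: nat and u :: "real \<Rightarrow> real" and N :: "nat \<Rightarrow> nat" and x :: "nat \<Rightarrow> nat \<Rightarrow> real"
    and h :: "nat \<Rightarrow> real" and uh :: "nat \<Rightarrow> real \<Rightarrow> real" and c :: "nat \<Rightarrow> nat \<Rightarrow> real"
  defines "Q \<equiv> (\<lambda>n. \<Sum>j\<in>parity_indices k. smult (c n j) (legendre j))"
  assumes smooth: "C_on (k + 2) u {a..b}" and mesh: "\<forall>n. is_mesh a b (N n) (x n)"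
    and h: "\<forall>n. h n = mesh_size (N n) (x n)" and h0: "h \<longlonglongrightarrow> 0"
    and uh: "\<forall>n. uh n \<in> spline_space k (k - 1) (N n) (x n)"
    and x0: "x0 \<in> {a<..<b}" and C: "0 < Cstar"
    and unif: "\<forall>\<^sub>F n in sequentially. uniform_near Cstar x0 (N n) (x n)"
    and exp: "error_expansion k x0 N x (\<lambda>n y. u y - uh n y) c"
    and i: "i < k"
  shows "(\<lambda>n. coeff (shift_diff (Q n)) i) \<in> O(\<lambda>n. h n ^ (k + 2))"
proof -
  have h_pos: "0 < h n" for n using mesh h mesh_size_pos by metis
  obtain T CT where T: "\<And>\<xi>. degree (T \<xi> :: real poly) \<le> k + 1"
    "\<And>\<xi> y. \<xi> \<in> {a<..<b} \<Longrightarrow> y \<in> {a<..<b} \<Longrightarrow> \<bar>u y - poly (T \<xi>) (y - \<xi>)\<bar> \<le> CT * \<bar>y - \<xi>\<bar> ^ (k + 2)"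
    using C_on_Taylor[of "k + 1" u a b] smooth by auto
  have CT: "0 \<le> CT"
  proof -
    define y where "y = (x0 + b) / 2"
    have "y \<in> {a<..<b}" "0 < \<bar>y - x0\<bar> ^ (k + 2)" using x0 by (auto simp: y_def)
    moreover from this(1) have "0 \<le> CT * \<bar>y - x0\<bar> ^ (k + 2)" using T(2)[OF x0]
        by (meson abs_ge_zero order_trans)
    ultimately show ?thesis by (simp add: zero_le_mult_iff)
  qed
  obtain CE where CE: "\<forall>\<^sub>F n in sequentially. \<forall>i\<in>interior_elements 2 x0 (N n) (x n). \<forall>y\<in>{x n i..x n (i + 1)}.
      \<bar>(u y - uh n y) - poly (Q n) (2 * (y - midpt (x n) i) / h n)\<bar> \<le> CE * h n ^ (k + 2)"
    using exp h unfolding error_expansion_def Q_def by (auto simp: poly_sum)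
  \<comment> \<open>In terms of the notation above, \<open>U = A - p\<close> and \<open>V = A - q\<close>.\<close>
  define good where "good n U V \<longleftrightarrow> (\<forall>j<k. coeff U j = coeff V j) \<and>
      (\<forall>s\<in>{-2..0}. \<bar>poly U s - poly (Q n) (s + 1)\<bar> \<le> (CE + CT) * h n ^ (k + 2)) \<and>
      (\<forall>s\<in>{0..2}. \<bar>poly V s - poly (Q n) (s - 1)\<bar> \<le> (CE + CT) * h n ^ (k + 2))" for n U V
  have "\<forall>\<^sub>F n in sequentially. 3 \<le> Cstar * \<bar>ln (h n)\<bar>"
  proof -
    have "filterlim h (at_right 0) sequentially"
      using h0 h_pos less_imp_neq[OF h_pos, symmetric] by (simp add: filterlim_at)
    then have "filterlim (\<lambda>n. ln (h n)) at_bot sequentially"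
      by (rule filterlim_compose[OF ln_at_0])
    then have "\<forall>\<^sub>F n in sequentially. ln (h n) \<le> - (3 / Cstar)" by (simp add: filterlim_at_bot)
    then show ?thesis
    proof eventually_elim
      case (elim n)
      then have "3 / Cstar \<le> \<bar>ln (h n)\<bar>" by linarith
      then show ?case using C by (simp add: field_simps)
    qed
  qed
  moreover have "\<forall>\<^sub>F n in sequentially. h n < min (x0 - a) (b - x0) / 2"
    using x0 by (intro order_tendstoD(2)[OF h0]) auto
  ultimately have "\<forall>\<^sub>F n in sequentially. \<exists>U V. degree U \<le> k + 1 \<and> degree V \<le> k + 1 \<and> good n U V"
    using unif CE
  proof eventually_elim
    case (elim n)
    have hn: "0 < h n" by (rule h_pos)
    have mesh_n: "is_mesh a b (N n) (x n)" and h_n: "mesh_size (N n) (x n) = h n" using mesh h by auto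
    obtain m where m: "1 < m" "m \<le> N n" "x n m - x n (m - 1) = h n" "x n (m + 1) - x n m = h n"
        "\<bar>x n m - x0\<bar> \<le> h n"
      using uniform_near_node[OF elim(3) mesh_n] elim(1) unfolding h_n by blast
    have "m - 1 + 1 = m" using m(1) by simp
    define \<xi> where "\<xi> = x n m"
    have near: "y \<in> {a<..<b}" if "\<bar>y - \<xi>\<bar> \<le> h n" for y
      using that m(5) elim(2) unfolding \<xi>_def by (auto simp: abs_le_iff)
    have \<xi>: "\<xi> \<in> {a<..<b}" using near[of \<xi>] hn by simp
    have "uh n \<in> spline_space k (k - 1) (N n) (x n)" using uh by blast
    moreover have "x n 1 < x n m" "x n m < x n (N n + 1)" using \<xi> mesh_n by (auto simp: \<xi>_def is_mesh_def)
    ultimately obtain p q where pq: "degree p \<le> k" "degree q \<le> k"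
        "\<And>y. y \<in> {x n (m - 1)..x n m} \<Longrightarrow> uh n y = poly p y"
      "\<And>y. y \<in> {x n m..x n (m + 1)} \<Longrightarrow> uh n y = poly q y"
      and match: "\<And>j. j \<le> k - 1 \<Longrightarrow> poly ((pderiv ^^ j) p) (x n m) = poly ((pderiv ^^ j) q) (x n m)"
      using spline_pieces[OF _ mesh_n m(1,2)] by metis
    define A where "A = T \<xi> \<circ>\<^sub>p [:0, h n / 2:]"
    define U where "U = A - p \<circ>\<^sub>p [:\<xi>, h n / 2:]"
    define V where "V = A - q \<circ>\<^sub>p [:\<xi>, h n / 2:]"
    have lin: "degree (r \<circ>\<^sub>p [:d, h n / 2:]) \<le> degree r" for r :: "real poly" and d
      using degree_pcompose_le[of r "[:d, h n / 2:]"] by (auto intro: order.trans)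
    have deg: "degree U \<le> k + 1" "degree V \<le> k + 1"
      unfolding U_def V_def A_def using T(1)[of \<xi>] pq(1,2)
      by (auto intro!: degree_diff_le order.trans[OF lin])
    have "coeff U j = coeff V j" if "j < k" for j
    proof -
      have "coeff ((p - q) \<circ>\<^sub>p [:\<xi>, h n / 2:]) j = 0"
      proof (rule coeff_pcompose_eq_0)
        fix j' assume "j' \<le> j"
        then have "poly ((pderiv ^^ j') p) \<xi> = poly ((pderiv ^^ j') q) \<xi>" using match[of j'] that
            by (simp add: \<xi>_def)
        moreover have "(pderiv ^^ j') (p - q) = (pderiv ^^ j') p - (pderiv ^^ j') q"
          by (induction j') (simp_all add: pderiv_diff)
        ultimately show "poly ((pderiv ^^ j') (p - q)) \<xi> = 0" by simp
      qed
      then show ?thesis by (simp add: U_def V_def pcompose_diff)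
    qed
    moreover have taylor: "\<bar>u (\<xi> + h n / 2 * s) - poly A s\<bar> \<le> CT * h n ^ (k + 2)" if "\<bar>s\<bar> \<le> 2" for s
    proof -
      have s: "\<bar>h n / 2 * s\<bar> \<le> h n" using that hn mult_left_mono[OF that, of "h n / 2"] by (simp add: abs_mult)
      have "\<bar>u (\<xi> + h n / 2 * s) - poly A s\<bar> \<le> CT * \<bar>h n / 2 * s\<bar> ^ (k + 2)"
        using T(2)[OF \<xi> near, of "\<xi> + h n / 2 * s"] s by (simp add: A_def poly_pcompose mult.commute)
      also have "\<dots> \<le> CT * h n ^ (k + 2)" using s CT by (intro mult_left_mono power_mono) auto
      finally show ?thesis .
    qed
    moreover have "\<bar>poly U s - poly (Q n) (s + 1)\<bar> \<le> (CE + CT) * h n ^ (k + 2)" if s: "s \<in> {-2..0}" for s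
    proof -
      define y where "y = \<xi> + h n / 2 * s"
      have mid: "midpt (x n) (m - 1) = \<xi> - h n / 2" using m by (simp add: midpt_def \<xi>_def)
      have "m - 1 \<in> interior_elements 2 x0 (N n) (x n)"
      proof -
        have "\<bar>midpt (x n) (m - 1) - x0\<bar> \<le> 2 * h n" unfolding mid using m(5) hn unfolding \<xi>_def by linarith
        then show ?thesis using m(1,2) by (auto simp: interior_elements_def h_n)
      qed
      moreover have y: "y \<in> {x n (m - 1)..x n m}"
        using s hn m(3) mult_left_mono[of "-2" s "h n / 2"] mult_nonneg_nonpos[of "h n / 2" s]
            by (auto simp: y_def \<xi>_def)
      moreover have "2 * (y - midpt (x n) (m - 1)) / h n = s + 1"
        unfolding mid y_def using hn by (simp add: field_simps)
      ultimately have "\<bar>(u y - poly p y) - poly (Q n) (s + 1)\<bar> \<le> CE * h n ^ (k + 2)"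
        using elim(4) pq(3)[OF y] \<open>m - 1 + 1 = m\<close> by metis
      moreover have "poly U s = poly A s - poly p y" by (simp add: U_def poly_pcompose y_def mult.commute)
      moreover have "\<bar>u y - poly A s\<bar> \<le> CT * h n ^ (k + 2)" using taylor[of s] s by (simp add: y_def)
      ultimately show ?thesis unfolding distrib_right by linarith
    qed
    moreover have "\<bar>poly V s - poly (Q n) (s - 1)\<bar> \<le> (CE + CT) * h n ^ (k + 2)" if s: "s \<in> {0..2}" for s
    proof -
      define y where "y = \<xi> + h n / 2 * s"
      have mid: "midpt (x n) m = \<xi> + h n / 2" using m by (simp add: midpt_def \<xi>_def)
      have "m \<in> interior_elements 2 x0 (N n) (x n)"
      proof -
        have "\<bar>midpt (x n) m - x0\<bar> \<le> 2 * h n" unfolding mid using m(5) hn unfolding \<xi>_def by linarith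
        then show ?thesis using m(1,2) by (auto simp: interior_elements_def h_n)
      qed
      moreover have y: "y \<in> {x n m..x n (m + 1)}"
      proof -
        have "0 \<le> h n / 2 * s" "h n / 2 * s \<le> h n" using s hn mult_left_mono[of s 2 "h n / 2"] by auto
        then show ?thesis using m(4) unfolding atLeastAtMost_iff y_def \<xi>_def by linarith
      qed
      moreover have "2 * (y - midpt (x n) m) / h n = s - 1"
        unfolding mid y_def using hn by (simp add: field_simps)
      ultimately have "\<bar>(u y - poly q y) - poly (Q n) (s - 1)\<bar> \<le> CE * h n ^ (k + 2)"
        using elim(4) pq(4) by metis
      moreover have "poly V s = poly A s - poly q y" by (simp add: V_def poly_pcompose y_def mult.commute)
      moreover have "\<bar>u y - poly A s\<bar> \<le> CT * h n ^ (k + 2)" using taylor[of s] s by (simp add: y_def)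
      ultimately show ?thesis unfolding distrib_right by linarith
    qed
    ultimately have "good n U V" unfolding good_def by blast
    with deg show ?case by blast
  qed
  then have ev: "\<forall>\<^sub>F n in sequentially. \<exists>U V. degree U \<le> k + 1 \<and> degree V \<le> k + 1 \<and> good n U V" .
  \<comment> \<open>The polynomials exist only for large \<open>n\<close>; the zero polynomials stand in for the others.\<close>
  have "\<exists>W. degree (fst W) \<le> k + 1 \<and> degree (snd W) \<le> k + 1 \<and>
      ((\<exists>U V. degree U \<le> k + 1 \<and> degree V \<le> k + 1 \<and> good n U V) \<longrightarrow> good n (fst W) (snd W))" for n
  proof (cases "\<exists>U V. degree U \<le> k + 1 \<and> degree V \<le> k + 1 \<and> good n U V")
    case True
    then show ?thesis by auto
  next
    case False
    then show ?thesis by (intro exI[of _ "(0, 0)"]) auto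
  qed
  then obtain W where W: "\<And>n. degree (fst (W n)) \<le> k + 1" "\<And>n. degree (snd (W n)) \<le> k + 1"
    "\<And>n. (\<exists>U V. degree U \<le> k + 1 \<and> degree V \<le> k + 1 \<and> good n U V) \<Longrightarrow> good n (fst (W n)) (snd (W n))"
    by metis
  define U where "U n = fst (W n)" for n
  define V where "V n = snd (W n)" for n
  have good: "\<forall>\<^sub>F n in sequentially. good n (U n) (V n)"
    using ev by eventually_elim (use W(3) in \<open>auto simp: U_def V_def\<close>)
  have "degree (Q n) \<le> k + 1" for n
    unfolding Q_def parity_indices_def
    by (intro degree_sum_le) (auto intro: order.trans[OF degree_smult_le] simp: degree_legendre)
  moreover have lin: "degree (r \<circ>\<^sub>p [:d, 1:]) \<le> degree r" for r :: "real poly" and d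
    using degree_pcompose_le[of r "[:d, 1:]"] by auto
  ultimately have degQ: "degree (Q n \<circ>\<^sub>p [:d, 1:]) \<le> k + 1" for n d by (meson order.trans)
  have left: "(\<lambda>n. coeff (U n - Q n \<circ>\<^sub>p [:1, 1:]) i) \<in> O(\<lambda>n. h n ^ (k + 2))"
  proof (rule coeff_bigo_of_pointwise)
    show "degree (U n - Q n \<circ>\<^sub>p [:1, 1:]) \<le> k + 1" for n
      using degQ W(1) by (auto simp: U_def intro: degree_diff_le)
    show "infinite {-2..0 :: real}" by (simp add: infinite_Icc)
    fix s :: real assume s: "s \<in> {-2..0}"
    show "(\<lambda>n. poly (U n - Q n \<circ>\<^sub>p [:1, 1:]) s) \<in> O(\<lambda>n. h n ^ (k + 2))"
    proof (rule bigoI)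
      show "\<forall>\<^sub>F n in sequentially. norm (poly (U n - Q n \<circ>\<^sub>p [:1, 1:]) s) \<le> (CE + CT) * norm (h n ^ (k + 2))"
        using good by eventually_elim (use s h_pos in
            \<open>auto simp: good_def poly_pcompose add.commute abs_of_pos\<close>)
    qed
  qed
  have right: "(\<lambda>n. coeff (V n - Q n \<circ>\<^sub>p [:-1, 1:]) i) \<in> O(\<lambda>n. h n ^ (k + 2))"
  proof (rule coeff_bigo_of_pointwise)
    show "degree (V n - Q n \<circ>\<^sub>p [:-1, 1:]) \<le> k + 1" for n
      using degQ W(2) by (auto simp: V_def intro: degree_diff_le)
    show "infinite {0..2 :: real}" by (simp add: infinite_Icc)
    fix s :: real assume s: "s \<in> {0..2}"
    show "(\<lambda>n. poly (V n - Q n \<circ>\<^sub>p [:-1, 1:]) s) \<in> O(\<lambda>n. h n ^ (k + 2))"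
    proof (rule bigoI)
      show "\<forall>\<^sub>F n in sequentially. norm (poly (V n - Q n \<circ>\<^sub>p [:-1, 1:]) s) \<le> (CE + CT) * norm (h n ^ (k + 2))"
        using good by eventually_elim (use s h_pos in \<open>auto simp: good_def poly_pcompose abs_of_pos\<close>)
    qed
  qed
  have "(\<lambda>n. coeff (V n - Q n \<circ>\<^sub>p [:-1, 1:]) i - coeff (U n - Q n \<circ>\<^sub>p [:1, 1:]) i) \<in> O(\<lambda>n. h n ^ (k + 2))"
    by (rule sum_in_bigo(2)[OF right left])
  moreover have "\<forall>\<^sub>F n in sequentially. coeff (V n - Q n \<circ>\<^sub>p [:-1, 1:]) i - coeff (U n - Q n \<circ>\<^sub>p [:1, 1:]) i
      = coeff (shift_diff (Q n)) i"
    using good by eventually_elim (use i in \<open>auto simp: good_def shift_diff_def\<close>)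
  ultimately show ?thesis by (rule landau_o.big.in_cong[THEN iffD1, rotated])
qed

section \<open>The leading error polynomial\<close>

lemma smult_sum_right: "smult c (\<Sum>j\<in>A. f j) = (\<Sum>j\<in>A. smult c (f j))"
  by (induction A rule: infinite_finite_induct) (auto simp: smult_add_right)

text \<open>
With \<open>\<gamma>\<^sub>j\<close> the Legendre coefficients of \<open>F\<^sub>k\<close>, normalised by \<open>\<gamma>\<^bsub>k+1\<^esub> = 1\<close>, the combination of the
\<open>L\<^sub>j\<close> with weights \<open>c\<^sub>j - c\<^bsub>k+1\<^esub> \<gamma>\<^sub>j\<close> has no \<open>L\<^bsub>k+1\<^esub>\<close>-term.  Its central difference differs from
that of \<open>\<Sum> c\<^sub>j L\<^sub>j\<close> by a multiple of \<open>s\<^sup>k\<close>, which is invisible in the coefficients below order \<open>k\<close>.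
\<close>

lemma leading_coefficients:
  fixes c :: "nat \<Rightarrow> nat \<Rightarrow> real" and h :: "nat \<Rightarrow> real"
  assumes Q: "\<And>i. i < k \<Longrightarrow>
      (\<lambda>n. coeff (shift_diff (\<Sum>j\<in>parity_indices k. smult (c n j) (legendre j))) i) \<in> O(g)"
  shows "\<exists>a. a \<noteq> 0 \<and> (\<exists>\<gamma>. smult a (Fpoly k) = (\<Sum>j\<in>parity_indices k - {0}. smult (\<gamma> j) (legendre j)) \<and>
      (\<forall>j\<in>parity_indices k - {0}. (\<lambda>n. c n j - c n (k + 1) * \<gamma> j) \<in> O(g)))"
proof -
  obtain b where b: "b (k + 1) \<noteq> 0" "Fpoly k = (\<Sum>j\<in>parity_indices k - {0}. smult (b j) (legendre j))"
    using Fpoly_legendre_expansion by blast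
  define \<gamma> where "\<gamma> j = b j / b (k + 1)" for j
  have P: "smult (1 / b (k + 1)) (Fpoly k) = (\<Sum>j\<in>parity_indices k - {0}. smult (\<gamma> j) (legendre j))"
    by (simp add: b(2) \<gamma>_def smult_sum_right)
  have fin: "finite (parity_indices k)" by (simp add: parity_indices_def)
  have top: "k + 1 \<in> parity_indices k" by (simp add: parity_indices_def)
  define w where "w n j = (if Suc j \<in> parity_indices k then c n (Suc j) - c n (k + 1) * \<gamma> (Suc j) else 0)"
      for n j
  have sum_w: "(\<Sum>j<k. smult (w n j) (shift_diff (legendre (Suc j)))) =
      shift_diff (\<Sum>j\<in>parity_indices k. smult (c n j) (legendre j))
          - smult (c n (k + 1) / b (k + 1)) (monom (2 / fact k) k)" for n
  proof -
    \<comment> \<open>The weight of \<open>L\<^bsub>k+1\<^esub>\<close> is zero, so it may be included.\<close>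
    have "(\<Sum>j<k. smult (w n j) (shift_diff (legendre (Suc j))))
        = (\<Sum>j<Suc k. smult (w n j) (shift_diff (legendre (Suc j))))"
      using b(1) by (simp add: w_def \<gamma>_def del: legendre.simps)
    also have "\<dots> = (\<Sum>j\<in>{1..k + 1}. if j \<in> parity_indices k then smult (c n j - c n (k + 1) * \<gamma> j)
        (shift_diff (legendre j)) else 0)"
      by (rule sum.reindex_bij_witness[where i = "\<lambda>j. j - 1" and j = Suc])
          (auto simp: w_def simp del: legendre.simps)
    also have "\<dots> = (\<Sum>j\<in>{1..k + 1} \<inter> parity_indices k. smult (c n j - c n (k + 1) * \<gamma> j)
        (shift_diff (legendre j)))"
      by (rule sum.inter_restrict[symmetric]) simp
    also have "{1..k + 1} \<inter> parity_indices k = parity_indices k - {0}"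
      by (auto simp: parity_indices_def)
    also have "(\<Sum>j\<in>parity_indices k - {0}. smult (c n j - c n (k + 1) * \<gamma> j) (shift_diff (legendre j))) =
        shift_diff (\<Sum>j\<in>parity_indices k - {0}. smult (c n j) (legendre j))
            - smult (c n (k + 1)) (shift_diff (smult (1 / b (k + 1)) (Fpoly k)))"
      unfolding P by (simp add: shift_diff_sum shift_diff_smult smult_sum_right smult_diff_left
          sum_subtractf del: legendre.simps)
    also have "shift_diff (\<Sum>j\<in>parity_indices k - {0}. smult (c n j) (legendre j))
        = shift_diff (\<Sum>j\<in>parity_indices k. smult (c n j) (legendre j))"
      using fin by (cases "0 \<in> parity_indices k")
        (simp_all add: sum.remove[of "parity_indices k" 0] shift_diff_add shift_diff_const del:
            legendre.simps(2,3))
    also have "shift_diff (smult (1 / b (k + 1)) (Fpoly k)) = smult (1 / b (k + 1)) (monom (2 / fact k) k)"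
      by (simp add: shift_diff_smult shift_diff_Fpoly)
    finally show ?thesis by simp
  qed
  have w: "(\<lambda>n. w n j) \<in> O(g)" if "j < k" for j
  proof (rule triangular_bigo[where p = "\<lambda>j. shift_diff (legendre (Suc j))" and k = k])
    fix j
    have "degree (legendre (Suc j)) \<le> Suc j" using degree_coeff_legendre by blast
    note shift = degree_coeff_shift_diff[OF this]
    show "degree (shift_diff (legendre (Suc j))) \<le> j" using shift by blast
    show "coeff (shift_diff (legendre (Suc j))) j \<noteq> 0"
      using shift degree_coeff_legendre[of "Suc j"] by (simp del: legendre.simps)
  next
    fix i assume i: "i < k"
    then have "coeff (\<Sum>j<k. smult (w n j) (shift_diff (legendre (Suc j)))) i =
        coeff (shift_diff (\<Sum>j\<in>parity_indices k. smult (c n j) (legendre j))) i" for n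
      by (simp add: sum_w coeff_diff del: legendre.simps)
    then show "(\<lambda>n. coeff (\<Sum>j<k. smult (w n j) (shift_diff (legendre (Suc j)))) i) \<in> O(g)"
      using Q[OF i] by simp
  qed (use that in simp)
  have "(\<lambda>n. c n j - c n (k + 1) * \<gamma> j) \<in> O(g)" if j: "j \<in> parity_indices k - {0}" for j
  proof (cases "j = k + 1")
    case True
    then show ?thesis using b(1) by (simp add: \<gamma>_def)
  next
    case False
    then have "j - 1 < k" "Suc (j - 1) = j" using j by (auto simp: parity_indices_def)
    then show ?thesis using w[of "j - 1"] j by (simp add: w_def)
  qed
  with P b(1) show ?thesis by (intro exI[of _ "1 / b (k + 1)"] exI[of _ \<gamma>] conjI ballI) auto
qed

text \<open>
If two choices of a coefficient differed, \<open>c\<^bsub>k+1\<^esub>\<close> would be \<open>O(h\<^bsup>k+2\<^esup>)\<close>, which contradicts its lower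
bound of order \<open>h\<^bsup>k+1\<^esup>\<close>.
\<close>

lemma leading_error_poly_unique:
  assumes P: "leading_error_poly k h c P" and P': "leading_error_poly k h c P'"
    and h: "\<And>n. 0 < h n" "h \<longlonglongrightarrow> 0" and c: "(\<lambda>n. c n (k + 1)) \<in> \<Omega>(\<lambda>n. h n ^ (k + 1))"
  shows "P = P'"
proof -
  obtain g where g: "P = (\<Sum>j\<in>parity_indices k - {0}. smult (g j) (legendre j))"
    "\<And>j. j \<in> parity_indices k - {0} \<Longrightarrow> (\<lambda>n. c n j - c n (k + 1) * g j) \<in> O(\<lambda>n. h n ^ (k + 2))"
    using P unfolding leading_error_poly_def by blast
  obtain g' where g': "P' = (\<Sum>j\<in>parity_indices k - {0}. smult (g' j) (legendre j))"
    "\<And>j. j \<in> parity_indices k - {0} \<Longrightarrow> (\<lambda>n. c n j - c n (k + 1) * g' j) \<in> O(\<lambda>n. h n ^ (k + 2))"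
    using P' unfolding leading_error_poly_def by blast
  have "g j = g' j" if j: "j \<in> parity_indices k - {0}" for j
  proof (rule ccontr)
    assume ne: "g j \<noteq> g' j"
    have "(\<lambda>n. (g j - g' j) * c n (k + 1)) \<in> O(\<lambda>n. h n ^ (k + 2))"
      using sum_in_bigo(2)[OF g'(2)[OF j] g(2)[OF j]] by (simp add: algebra_simps)
    then have "(\<lambda>n. c n (k + 1)) \<in> O(\<lambda>n. h n ^ (k + 2))"
      using ne by (subst (asm) landau_o.big.cmult_in_iff) auto
    then have "(\<lambda>n. h n ^ (k + 1)) \<in> O(\<lambda>n. h n ^ (k + 2))"
      using c landau_o.big.trans by (auto simp: bigomega_iff_bigo)
    then obtain C where C: "0 < C" "\<forall>\<^sub>F n in sequentially. norm (h n ^ (k + 1)) \<le> C * norm (h n ^ (k + 2))"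
      by (elim landau_o.bigE)
    moreover have "\<forall>\<^sub>F n in sequentially. h n < 1 / C" using C(1) by (intro order_tendstoD(2)[OF h(2)]) simp
    ultimately have "\<forall>\<^sub>F n in sequentially. norm (h n ^ (k + 1)) \<le> C * norm (h n ^ (k + 2)) \<and> h n < 1 / C"
      by (simp add: eventually_conj_iff)
    then obtain n where n: "norm (h n ^ (k + 1)) \<le> C * norm (h n ^ (k + 2))" "h n < 1 / C"
      using eventually_happens'[OF sequentially_bot] by blast
    have "h n ^ (k + 1) * 1 \<le> h n ^ (k + 1) * (C * h n)" using n(1) h(1)[of n] by (simp add: mult_ac)
    then have "1 \<le> C * h n" using h(1)[of n] by (subst (asm) mult_le_cancel_left_pos) auto
    then show False using n(2) C(1) by (simp add: field_simps)
  qed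
  then show ?thesis using g(1) g'(1) by simp
qed

lemma admissible_iff_closed: "s < k \<Longrightarrow> admissible k (k - 1) s t \<longleftrightarrow> t \<in> {-1..1}"
  by (auto simp: admissible_def)

lemma admissible_iff_open: "1 \<le> k \<Longrightarrow> admissible k (k - 1) k t \<longleftrightarrow> t \<in> {-1<..<1}"
  by (auto simp: admissible_def)

lemma superconvergence_points_smult_Fpoly:
  assumes "s \<le> k" "a \<noteq> 0"
  shows "superconvergence_points k \<mu> (smult a (Fpoly k)) s
      = {t. admissible k \<mu> s t \<and> poly (Fpoly (k - s)) t = 0}"
proof -
  have "(pderiv ^^ s) (smult a (Fpoly k)) = smult a ((pderiv ^^ s) (Fpoly k))"
    by (rule higher_pderiv_smult)
  then show ?thesis using assms by (simp add: superconvergence_points_def pderiv_power_Fpoly)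
qed

text \<open>
For \<open>s < k\<close> the whole closed interval is admissible; for \<open>s = k\<close> the nodes are excluded and
\<open>F\<^sub>0 = t\<close>.
\<close>

lemma admissible_zeros_Fpoly:
  assumes "1 \<le> k" "s \<le> k"
  defines "Z \<equiv> {t. admissible k (k - 1) s t \<and> poly (Fpoly (k - s)) t = 0}"
  shows "even (k - s) \<Longrightarrow> Z = (if s = k then {0} else {-1, 0, 1})"
    and "odd (k - s) \<Longrightarrow> Z = {- pos_zero (k - s), pos_zero (k - s)}"
proof -
  have closed: "Z = {t\<in>{-1..1}. poly (Fpoly (k - s)) t = 0}" if "s < k"
    unfolding Z_def admissible_iff_closed[OF that] by blast
  show "Z = (if s = k then {0} else {-1, 0, 1})" if "even (k - s)"
  proof (cases "s = k")
    case True
    then show ?thesis unfolding Z_def True admissible_iff_open[OF assms(1)] by (auto simp: Fpoly_0)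
  next
    case False
    then show ?thesis using closed Fpoly_zeros_even[OF that] assms(2) by simp
  qed
  show "Z = {- pos_zero (k - s), pos_zero (k - s)}" if "odd (k - s)"
  proof -
    have "s < k" using that assms(2) by (cases "s = k") auto
    then show ?thesis using closed Fpoly_zeros_odd[OF that] by simp
  qed
qed


theorem theorem4p12:
  fixes k \<mu> :: nat and a b x0 Cstar :: real
    and u f :: "real \<Rightarrow> real"
    and N :: "nat \<Rightarrow> nat" and x :: "nat \<Rightarrow> nat \<Rightarrow> real" and h :: "nat \<Rightarrow> real"
    and uh :: "nat \<Rightarrow> real \<Rightarrow> real" and c :: "nat \<Rightarrow> nat \<Rightarrow> real"
  assumes "2 \<le> k" and "\<mu> = k - 1" and "a < b"
    and "C_on (k + 2) u {a..b}"
    and "\<forall>y\<in>{a<..<b}. - (deriv ^^ 2) u y = f y" and "u a = 0" and "u b = 0"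
    and "\<forall>n. is_mesh a b (N n) (x n)" and "quasi_uniform N x"
    and "\<forall>n. h n = mesh_size (N n) (x n)" and "h \<longlonglongrightarrow> 0"
    and "\<forall>n. uh n \<in> Vh k \<mu> (N n) (x n)"
    and "\<forall>n. \<forall>v\<in>Vh k \<mu> (N n) (x n).
           (LBINT y:{a<..<b}. deriv (\<lambda>z. u z - uh n z) y * deriv v y) = 0"
    and "x0 \<in> {a<..<b}" and "0 < Cstar"
    and "\<forall>\<^sub>F n in sequentially. uniform_near Cstar x0 (N n) (x n)"
    and "error_expansion k x0 N x (\<lambda>n y. u y - uh n y) c"
    and "(\<lambda>n. c n (k + 1)) \<in> \<Omega>(\<lambda>n. h n ^ (k + 1))"
  shows
    "(\<exists>!P. leading_error_poly k h c P) \<and>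
     (\<forall>P. leading_error_poly k h c P \<longrightarrow> (\<forall>s\<le>k.
        superconvergence_points k \<mu> P s = {t. admissible k \<mu> s t \<and> poly (Fpoly (k - s)) t = 0} \<and>
        (even (k - s) \<longrightarrow>
           superconvergence_points k \<mu> P s = (if s = k then {0} else {-1, 0, 1})) \<and>
        (odd (k - s) \<longrightarrow>
           superconvergence_points k \<mu> P s = {- pos_zero (k - s), pos_zero (k - s)}))) \<and>
     {t\<in>{-1..1}. poly (Fpoly 0) t = 0} = {0} \<and> order 0 (Fpoly 0) = 1 \<and>
     (\<forall>n. even n \<and> 0 < n \<longrightarrow>
        {t\<in>{-1..1}. poly (Fpoly n) t = 0} = {-1, 0, 1} \<and>
        (\<forall>t\<in>{-1, 0, 1}. order t (Fpoly n) = 1)) \<and>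
     (\<forall>n. odd n \<longrightarrow>
        0 < pos_zero n \<and> pos_zero n < 1 \<and>
        {t\<in>{-1..1}. poly (Fpoly n) t = 0} = {- pos_zero n, pos_zero n} \<and>
        order (pos_zero n) (Fpoly n) = 1 \<and> order (- pos_zero n) (Fpoly n) = 1) \<and>
     (pos_zero \<longlongrightarrow> 1 / 2) (inf sequentially (principal {n. odd n})) \<and>
     (\<lambda>n. pos_zero n - 1 / 2 -
        (1 / (pi * 2 ^ (n + 1)) - 1 / (pi * 4 ^ (n + 1)) + 4 / (pi * 6 ^ (n + 1))
          - 17 / (6 * pi * 8 ^ (n + 1))))
       \<in> O[inf sequentially (principal {n. odd n})](\<lambda>n. 1 / 10 ^ (n + 1))"
proof -
  have k: "1 \<le> k" and \<mu>: "\<mu> = k - 1" using assms(1,2) by auto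
  have h_pos: "0 < h n" for n using assms(8,10) mesh_size_pos by metis
  have uh: "\<forall>n. uh n \<in> spline_space k (k - 1) (N n) (x n)" using assms(12) \<mu> by (simp add: Vh_def)
  have coeffs: "(\<lambda>n. coeff (shift_diff (\<Sum>j\<in>parity_indices k. smult (c n j) (legendre j))) i)
      \<in> O(\<lambda>n. h n ^ (k + 2))"
    if "i < k" for i
    by (rule shift_diff_error_poly[OF assms(4,8,10,11) uh assms(14,15,16,17) that])
  obtain \<alpha> \<gamma> where \<alpha>: "\<alpha> \<noteq> 0"
    and \<gamma>: "smult \<alpha> (Fpoly k) = (\<Sum>j\<in>parity_indices k - {0}. smult (\<gamma> j) (legendre j))"
      "\<forall>j\<in>parity_indices k - {0}. (\<lambda>n. c n j - c n (k + 1) * \<gamma> j) \<in> O(\<lambda>n. h n ^ (k + 2))"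
    using leading_coefficients[OF coeffs] by blast
  have P: "leading_error_poly k h c (smult \<alpha> (Fpoly k))"
    unfolding leading_error_poly_def using \<gamma> by blast
  have unique: "P = smult \<alpha> (Fpoly k)" if "leading_error_poly k h c P" for P
    by (rule leading_error_poly_unique[OF that P h_pos assms(11,18)])
  have points: "superconvergence_points k \<mu> P s = {t. admissible k \<mu> s t \<and> poly (Fpoly (k - s)) t = 0} \<and>
        (even (k - s) \<longrightarrow>
           superconvergence_points k \<mu> P s = (if s = k then {0} else {-1, 0, 1})) \<and>
        (odd (k - s) \<longrightarrow>
           superconvergence_points k \<mu> P s = {- pos_zero (k - s), pos_zero (k - s)})"
    if "leading_error_poly k h c P" "s \<le> k" for P s
    unfolding unique[OF that(1)] superconvergence_points_smult_Fpoly[OF that(2) \<alpha>] \<mu>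
    by (intro conjI impI refl admissible_zeros_Fpoly[OF k that(2)])
  have "\<exists>!P. leading_error_poly k h c P" using P unique by blast
  moreover have "\<forall>P. leading_error_poly k h c P \<longrightarrow> (\<forall>s\<le>k.
        superconvergence_points k \<mu> P s = {t. admissible k \<mu> s t \<and> poly (Fpoly (k - s)) t = 0} \<and>
        (even (k - s) \<longrightarrow>
           superconvergence_points k \<mu> P s = (if s = k then {0} else {-1, 0, 1})) \<and>
        (odd (k - s) \<longrightarrow>
           superconvergence_points k \<mu> P s = {- pos_zero (k - s), pos_zero (k - s)}))"
    by (intro allI impI) (rule points)
  moreover have "\<forall>n. even n \<and> 0 < n \<longrightarrow>
        {t\<in>{-1..1}. poly (Fpoly n) t = 0} = {-1, 0, 1} \<and> (\<forall>t\<in>{-1, 0, 1}. order t (Fpoly n) = 1)"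
  proof (intro allI impI)
    fix n :: nat assume "even n \<and> 0 < n"
    then have "even n" "0 < n" by blast+
    then show "{t\<in>{-1..1}. poly (Fpoly n) t = 0} = {-1, 0, 1} \<and> (\<forall>t\<in>{-1, 0, 1}. order t (Fpoly n) = 1)"
      by (intro conjI ballI Fpoly_zeros_even order_Fpoly_even)
  qed
  moreover have "\<forall>n. odd n \<longrightarrow> 0 < pos_zero n \<and> pos_zero n < 1 \<and>
        {t\<in>{-1..1}. poly (Fpoly n) t = 0} = {- pos_zero n, pos_zero n} \<and>
        order (pos_zero n) (Fpoly n) = 1 \<and> order (- pos_zero n) (Fpoly n) = 1"
    by (intro allI impI conjI pos_zero_Fpoly(1,2) Fpoly_zeros_odd order_Fpoly_odd)
  ultimately show ?thesis
    by (intro conjI Fpoly_zeros_0 order_Fpoly_0 pos_zero_asymptotics)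
qed

end
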